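(* The category $\mathbf{Cal^0_{Sym}}$, equipped with the tensor bifunctor $\circledast$, unit object the two-element lattice $2$, internal hom $\mathcal{L}_1\multimap\mathcal{L}_2:=(\mathcal{L}_1\circledast\mathcal{L}_2^{\mathrm{op}})^{\mathrm{op}}$, and dualizing object $2$, is a $\ast$-autonomous category (i.e. symmetric monoidal closed with $2$ as dualizing object, so that $\mathcal{L}\multimap 2\cong\mathcal{L}^{\mathrm{op}}$ and the canonical arrow $\mathcal{L}\to(\mathcal{L}\multimap2)\multimap2$ is an isomorphism for every $\mathcal{L}$).
   Context: Lattice notation: $\Sigma_i,\Sigma_i'$ atoms and coatoms; $\Sigma[a]$, $\Sigma'[a]$ atoms below / coatoms above $a$; $\mathsf{Cl}(\omega)=\{\Sigma[a];a\in\omega\}$; $\mathcal{L}^{\mathrm{op}}$ dual lattice; $f^\circ(b):=\bigvee\{a;f(a)\le b\}$. $\mathbf{Cal^0_{Sym}}$: objects are complete atomistic coatomistic lattices with $\Sigma[x]\cup\Sigma[y]\ne\Sigma$ for all coatoms $x,y$ and $\Sigma'[p]\cup\Sigma'[q]\ne\Sigma'$ for all atoms $p,q$; arrows are maps preserving arbitrary joins, sending atoms to atoms or $0$, with $f^\circ$ sending coatoms to coatoms or $1$. $\Sigma'_\circledast$ is the set of $R\subsetneqq\Sigma_1\times\Sigma_2$ such that for every $(p_1,p_2)\in\Sigma_1\times\Sigma_2$, $\{q_1;(q_1,p_2)\in R\}\in\mathsf{Cl}(\Sigma_1'\cup\{1\})$ and $\{q_2;(p_1,q_2)\in R\}\in\mathsf{Cl}(\Sigma_2'\cup\{1\})$;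 $\mathcal{L}_1\circledast\mathcal{L}_2:=\{\bigcap\omega;\omega\subseteq\Sigma'_\circledast\cup\{\Sigma_1\times\Sigma_2\}\}$ ordered by inclusion; on arrows $f_1\circledast f_2$ is the join-preserving map sending the atom $\{(p_1,p_2)\}$ to $\{(f_1(p_1),f_2(p_2))\}$ if both are nonzero and to $0$ otherwise. *)

theory Defs
  imports Main "HOL-Library.FuncSet"
begin

record 'a lat =
  lcarrier :: "'a set"
  lle :: "'a \<Rightarrow> 'a \<Rightarrow> bool"

definition is_lub :: "'a lat \<Rightarrow> 'a set \<Rightarrow> 'a \<Rightarrow> bool" where
  "is_lub L A x \<longleftrightarrow> x \<in> lcarrier L \<and> (\<forall>a\<in>A. lle L a x)
     \<and> (\<forall>y\<in>lcarrier L. (\<forall>a\<in>A. lle L a y) \<longrightarrow> lle L x y)"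

definition Join :: "'a lat \<Rightarrow> 'a set \<Rightarrow> 'a" where
  "Join L A = (THE x. is_lub L A x)"

definition dual_lat :: "'a lat \<Rightarrow> 'a lat" where
  "dual_lat L = \<lparr>lcarrier = lcarrier L, lle = (\<lambda>x y. lle L y x)\<rparr>"

definition Meet :: "'a lat \<Rightarrow> 'a set \<Rightarrow> 'a" where
  "Meet L A = Join (dual_lat L) A"

definition lbot :: "'a lat \<Rightarrow> 'a" where "lbot L = Join L {}"
definition ltop :: "'a lat \<Rightarrow> 'a" where "ltop L = Meet L {}"

definition complete_lat :: "'a lat \<Rightarrow> bool" where
  "complete_lat L \<longleftrightarrow>
     (\<forall>x\<in>lcarrier L. lle L x x) \<and>
     (\<forall>x\<in>lcarrier L. \<forall>y\<in>lcarrier L. lle L x y \<and> lle L y x \<longrightarrow> x = y) \<and>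
     (\<forall>x\<in>lcarrier L. \<forall>y\<in>lcarrier L. \<forall>z\<in>lcarrier L. lle L x y \<and> lle L y z \<longrightarrow> lle L x z) \<and>
     (\<forall>A. A \<subseteq> lcarrier L \<longrightarrow> (\<exists>x. is_lub L A x))"

definition atoms :: "'a lat \<Rightarrow> 'a set" where
  "atoms L = {p \<in> lcarrier L. p \<noteq> lbot L \<and> (\<forall>x\<in>lcarrier L. lle L x p \<longrightarrow> x = lbot L \<or> x = p)}"

definition coatoms :: "'a lat \<Rightarrow> 'a set" where
  "coatoms L = atoms (dual_lat L)"

definition atoms_below :: "'a lat \<Rightarrow> 'a \<Rightarrow> 'a set" where
  "atoms_below L a = {p \<in> atoms L. lle L p a}"

definition coatoms_above :: "'a lat \<Rightarrow> 'a \<Rightarrow> 'a set" where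
  "coatoms_above L a = {c \<in> coatoms L. lle L a c}"

definition atomistic :: "'a lat \<Rightarrow> bool" where
  "atomistic L \<longleftrightarrow> (\<forall>a\<in>lcarrier L. a = Join L (atoms_below L a))"

definition coatomistic :: "'a lat \<Rightarrow> bool" where
  "coatomistic L \<longleftrightarrow> (\<forall>a\<in>lcarrier L. a = Meet L (coatoms_above L a))"

definition cal0sym_obj :: "'a lat \<Rightarrow> bool" where
  "cal0sym_obj L \<longleftrightarrow> complete_lat L \<and> atomistic L \<and> coatomistic L \<and>
     (\<forall>x\<in>coatoms L. \<forall>y\<in>coatoms L. atoms_below L x \<union> atoms_below L y \<noteq> atoms L) \<and>
     (\<forall>p\<in>atoms L. \<forall>q\<in>atoms L. coatoms_above L p \<union> coatoms_above L q \<noteq> coatoms L)"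

definition adj :: "'a lat \<Rightarrow> 'b lat \<Rightarrow> ('a \<Rightarrow> 'b) \<Rightarrow> 'b \<Rightarrow> 'a" where
  "adj L1 L2 f b = Join L1 {a \<in> lcarrier L1. lle L2 (f a) b}"

definition Hom :: "'a lat \<Rightarrow> 'b lat \<Rightarrow> ('a \<Rightarrow> 'b) set" where
  "Hom L1 L2 = {f. f \<in> extensional (lcarrier L1) \<and> f \<in> lcarrier L1 \<rightarrow> lcarrier L2 \<and>
     (\<forall>A. A \<subseteq> lcarrier L1 \<longrightarrow> f (Join L1 A) = Join L2 (f ` A)) \<and>
     (\<forall>p\<in>atoms L1. f p \<in> atoms L2 \<union> {lbot L2}) \<and>
     (\<forall>c\<in>coatoms L2. adj L1 L2 f c \<in> coatoms L1 \<union> {ltop L1})}"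

definition idA :: "'a lat \<Rightarrow> 'a \<Rightarrow> 'a" where
  "idA L = restrict (\<lambda>x. x) (lcarrier L)"

definition iso :: "'a lat \<Rightarrow> 'b lat \<Rightarrow> ('a \<Rightarrow> 'b) \<Rightarrow> bool" where
  "iso L1 L2 f \<longleftrightarrow> f \<in> Hom L1 L2 \<and>
     (\<exists>g\<in>Hom L2 L1. compose (lcarrier L1) g f = idA L1 \<and> compose (lcarrier L2) f g = idA L2)"

definition Cl :: "'a lat \<Rightarrow> 'a set \<Rightarrow> 'a set set" where
  "Cl L \<omega> = atoms_below L ` \<omega>"

definition tsr_gen :: "'a lat \<Rightarrow> 'b lat \<Rightarrow> ('a \<times> 'b) set set" where
  "tsr_gen L1 L2 = {R. R \<subset> atoms L1 \<times> atoms L2 \<and>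
     (\<forall>p1\<in>atoms L1. \<forall>p2\<in>atoms L2.
        {q1. (q1, p2) \<in> R} \<in> Cl L1 (coatoms L1 \<union> {ltop L1}) \<and>
        {q2. (p1, q2) \<in> R} \<in> Cl L2 (coatoms L2 \<union> {ltop L2}))}"

text \<open>Intersections are taken inside \<Sigma>1 \<times> \<Sigma>2 (empty intersection = \<Sigma>1 \<times> \<Sigma>2).\<close>
definition tensor :: "'a lat \<Rightarrow> 'b lat \<Rightarrow> ('a \<times> 'b) set lat" where
  "tensor L1 L2 = \<lparr>lcarrier = {(atoms L1 \<times> atoms L2) \<inter> \<Inter>\<omega> | \<omega>.
        \<omega> \<subseteq> tsr_gen L1 L2 \<union> {atoms L1 \<times> atoms L2}},
     lle = (\<subseteq>)\<rparr>"

text \<open>f1 \<circledast> f2: join-preserving extension of {(p1,p2)} \<mapsto> {(f1 p1, f2 p2)} (or 0).\<close>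
definition tensor_arr :: "'a lat \<Rightarrow> 'b lat \<Rightarrow> 'c lat \<Rightarrow> 'd lat \<Rightarrow> ('a \<Rightarrow> 'c) \<Rightarrow> ('b \<Rightarrow> 'd)
     \<Rightarrow> ('a \<times> 'b) set \<Rightarrow> ('c \<times> 'd) set" where
  "tensor_arr L1 L2 M1 M2 f1 f2 = restrict
     (\<lambda>R. Join (tensor M1 M2) {{(f1 p1, f2 p2)} | p1 p2.
        (p1, p2) \<in> R \<and> f1 p1 \<noteq> lbot M1 \<and> f2 p2 \<noteq> lbot M2})
     (lcarrier (tensor L1 L2))"

definition two :: "bool lat" where
  "two = \<lparr>lcarrier = UNIV, lle = (\<le>)\<rparr>"

definition ihom :: "'a lat \<Rightarrow> 'b lat \<Rightarrow> ('a \<times> 'b) set lat" where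
  "ihom L1 L2 = dual_lat (tensor L1 (dual_lat L2))"

section \<open>Canonical structure maps (join-preserving extensions of maps on atoms)\<close>

definition assoc :: "'a lat \<Rightarrow> 'b lat \<Rightarrow> 'c lat \<Rightarrow> (('a \<times> 'b) set \<times> 'c) set \<Rightarrow> ('a \<times> ('b \<times> 'c) set) set" where
  "assoc L1 L2 L3 = restrict
     (\<lambda>X. Join (tensor L1 (tensor L2 L3)) {{(p1, {(p2, p3)})} | p1 p2 p3. ({(p1, p2)}, p3) \<in> X})
     (lcarrier (tensor (tensor L1 L2) L3))"

definition lunit :: "'a lat \<Rightarrow> (bool \<times> 'a) set \<Rightarrow> 'a" where
  "lunit L = restrict (\<lambda>X. Join L {p. (True, p) \<in> X}) (lcarrier (tensor two L))"

definition runit :: "'a lat \<Rightarrow> ('a \<times> bool) set \<Rightarrow> 'a" where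
  "runit L = restrict (\<lambda>X. Join L {p. (p, True) \<in> X}) (lcarrier (tensor L two))"

definition symm :: "'a lat \<Rightarrow> 'b lat \<Rightarrow> ('a \<times> 'b) set \<Rightarrow> ('b \<times> 'a) set" where
  "symm L1 L2 = restrict (\<lambda>X. (\<lambda>(p, q). (q, p)) ` X) (lcarrier (tensor L1 L2))"

text \<open>Evaluation (L2 \<multimap> L3) \<circledast> L2 \<rightarrow> L3: an atom R of L2 \<multimap> L3 is a relation
  R \<subseteq> \<Sigma>2 \<times> \<Sigma>'3; the atom {(R,p2)} is sent to the meet of the coatoms q with (p2,q) \<in> R.\<close>
definition ev :: "'b lat \<Rightarrow> 'c lat \<Rightarrow> (('b \<times> 'c) set \<times> 'b) set \<Rightarrow> 'c" where
  "ev L2 L3 = restrict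
     (\<lambda>X. Join L3 {Meet L3 {q. (p2, q) \<in> R} | R p2. (R, p2) \<in> X})
     (lcarrier (tensor (ihom L2 L3) L2))"

definition category_laws :: "'a lat \<Rightarrow> 'b lat \<Rightarrow> 'c lat \<Rightarrow> ('a \<Rightarrow> 'b) \<Rightarrow> ('b \<Rightarrow> 'c) \<Rightarrow> bool" where
  "category_laws L M N f g \<longleftrightarrow>
     (cal0sym_obj L \<and> cal0sym_obj M \<and> cal0sym_obj N \<and> f \<in> Hom L M \<and> g \<in> Hom M N \<longrightarrow>
        idA L \<in> Hom L L \<and> compose (lcarrier L) g f \<in> Hom L N)"

definition tensor_bifunctor_laws ::
  "'a lat \<Rightarrow> 'b lat \<Rightarrow> 'c lat \<Rightarrow> 'd lat \<Rightarrow> 'e lat \<Rightarrow> 'f lat \<Rightarrow>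
   ('a \<Rightarrow> 'c) \<Rightarrow> ('b \<Rightarrow> 'd) \<Rightarrow> ('c \<Rightarrow> 'e) \<Rightarrow> ('d \<Rightarrow> 'f) \<Rightarrow> bool" where
  "tensor_bifunctor_laws L1 L2 M1 M2 N1 N2 f1 f2 g1 g2 \<longleftrightarrow>
     (cal0sym_obj L1 \<and> cal0sym_obj L2 \<and> cal0sym_obj M1 \<and> cal0sym_obj M2 \<and>
      cal0sym_obj N1 \<and> cal0sym_obj N2 \<and>
      f1 \<in> Hom L1 M1 \<and> f2 \<in> Hom L2 M2 \<and> g1 \<in> Hom M1 N1 \<and> g2 \<in> Hom M2 N2 \<longrightarrow>
        cal0sym_obj (tensor L1 L2) \<and>
        tensor_arr L1 L2 M1 M2 f1 f2 \<in> Hom (tensor L1 L2) (tensor M1 M2) \<and>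
        tensor_arr L1 L2 L1 L2 (idA L1) (idA L2) = idA (tensor L1 L2) \<and>
        tensor_arr L1 L2 N1 N2 (compose (lcarrier L1) g1 f1) (compose (lcarrier L2) g2 f2)
          = compose (lcarrier (tensor L1 L2)) (tensor_arr M1 M2 N1 N2 g1 g2)
              (tensor_arr L1 L2 M1 M2 f1 f2))"

definition assoc_laws ::
  "'a lat \<Rightarrow> 'b lat \<Rightarrow> 'c lat \<Rightarrow> 'd lat \<Rightarrow> 'e lat \<Rightarrow> 'f lat \<Rightarrow>
   ('a \<Rightarrow> 'd) \<Rightarrow> ('b \<Rightarrow> 'e) \<Rightarrow> ('c \<Rightarrow> 'f) \<Rightarrow> bool" where
  "assoc_laws L1 L2 L3 M1 M2 M3 f1 f2 f3 \<longleftrightarrow>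
     (cal0sym_obj L1 \<and> cal0sym_obj L2 \<and> cal0sym_obj L3 \<and>
      cal0sym_obj M1 \<and> cal0sym_obj M2 \<and> cal0sym_obj M3 \<and>
      f1 \<in> Hom L1 M1 \<and> f2 \<in> Hom L2 M2 \<and> f3 \<in> Hom L3 M3 \<longrightarrow>
        iso (tensor (tensor L1 L2) L3) (tensor L1 (tensor L2 L3)) (assoc L1 L2 L3) \<and>
        compose (lcarrier (tensor (tensor L1 L2) L3))
          (tensor_arr L1 (tensor L2 L3) M1 (tensor M2 M3) f1 (tensor_arr L2 L3 M2 M3 f2 f3))
          (assoc L1 L2 L3)
        = compose (lcarrier (tensor (tensor L1 L2) L3))
          (assoc M1 M2 M3)
          (tensor_arr (tensor L1 L2) L3 (tensor M1 M2) M3 (tensor_arr L1 L2 M1 M2 f1 f2) f3))"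

definition unit_laws :: "'a lat \<Rightarrow> 'b lat \<Rightarrow> ('a \<Rightarrow> 'b) \<Rightarrow> bool" where
  "unit_laws L M f \<longleftrightarrow>
     (cal0sym_obj L \<and> cal0sym_obj M \<and> f \<in> Hom L M \<longrightarrow>
        iso (tensor two L) L (lunit L) \<and> iso (tensor L two) L (runit L) \<and>
        compose (lcarrier (tensor two L)) f (lunit L)
          = compose (lcarrier (tensor two L)) (lunit M) (tensor_arr two L two M (idA two) f) \<and>
        compose (lcarrier (tensor L two)) f (runit L)
          = compose (lcarrier (tensor L two)) (runit M) (tensor_arr L two M two f (idA two)))"

definition symmetry_laws ::
  "'a lat \<Rightarrow> 'b lat \<Rightarrow> 'c lat \<Rightarrow> 'd lat \<Rightarrow> ('a \<Rightarrow> 'c) \<Rightarrow> ('b \<Rightarrow> 'd) \<Rightarrow> bool" where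
  "symmetry_laws L1 L2 M1 M2 f1 f2 \<longleftrightarrow>
     (cal0sym_obj L1 \<and> cal0sym_obj L2 \<and> cal0sym_obj M1 \<and> cal0sym_obj M2 \<and>
      f1 \<in> Hom L1 M1 \<and> f2 \<in> Hom L2 M2 \<longrightarrow>
        iso (tensor L1 L2) (tensor L2 L1) (symm L1 L2) \<and>
        compose (lcarrier (tensor L1 L2)) (symm L2 L1) (symm L1 L2) = idA (tensor L1 L2) \<and>
        compose (lcarrier (tensor L1 L2)) (symm M1 M2) (tensor_arr L1 L2 M1 M2 f1 f2)
          = compose (lcarrier (tensor L1 L2)) (tensor_arr L2 L1 M2 M1 f2 f1) (symm L1 L2))"

definition pentagon_law :: "'a lat \<Rightarrow> 'b lat \<Rightarrow> 'c lat \<Rightarrow> 'd lat \<Rightarrow> bool" where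
  "pentagon_law L1 L2 L3 L4 \<longleftrightarrow>
     (cal0sym_obj L1 \<and> cal0sym_obj L2 \<and> cal0sym_obj L3 \<and> cal0sym_obj L4 \<longrightarrow>
       compose (lcarrier (tensor (tensor (tensor L1 L2) L3) L4))
         (assoc L1 L2 (tensor L3 L4)) (assoc (tensor L1 L2) L3 L4)
       = compose (lcarrier (tensor (tensor (tensor L1 L2) L3) L4))
           (tensor_arr L1 (tensor (tensor L2 L3) L4) L1 (tensor L2 (tensor L3 L4))
              (idA L1) (assoc L2 L3 L4))
           (compose (lcarrier (tensor (tensor (tensor L1 L2) L3) L4))
              (assoc L1 (tensor L2 L3) L4)
              (tensor_arr (tensor (tensor L1 L2) L3) L4 (tensor L1 (tensor L2 L3)) L4
                 (assoc L1 L2 L3) (idA L4))))"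

definition triangle_law :: "'a lat \<Rightarrow> 'b lat \<Rightarrow> bool" where
  "triangle_law L1 L2 \<longleftrightarrow>
     (cal0sym_obj L1 \<and> cal0sym_obj L2 \<longrightarrow>
       compose (lcarrier (tensor (tensor L1 two) L2))
         (tensor_arr L1 (tensor two L2) L1 L2 (idA L1) (lunit L2)) (assoc L1 two L2)
       = tensor_arr (tensor L1 two) L2 L1 L2 (runit L1) (idA L2))"

definition hexagon_law :: "'a lat \<Rightarrow> 'b lat \<Rightarrow> 'c lat \<Rightarrow> bool" where
  "hexagon_law A B C \<longleftrightarrow>
     (cal0sym_obj A \<and> cal0sym_obj B \<and> cal0sym_obj C \<longrightarrow>
       compose (lcarrier (tensor (tensor A B) C))
         (assoc B C A)
         (compose (lcarrier (tensor (tensor A B) C)) (symm A (tensor B C)) (assoc A B C))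
       = compose (lcarrier (tensor (tensor A B) C))
         (tensor_arr B (tensor A C) B (tensor C A) (idA B) (symm A C))
         (compose (lcarrier (tensor (tensor A B) C))
            (assoc B A C)
            (tensor_arr (tensor A B) C (tensor B A) C (symm A B) (idA C))))"

definition closed_law :: "'a lat \<Rightarrow> 'b lat \<Rightarrow> 'c lat \<Rightarrow> bool" where
  "closed_law L1 L2 L3 \<longleftrightarrow>
     (cal0sym_obj L1 \<and> cal0sym_obj L2 \<and> cal0sym_obj L3 \<longrightarrow>
       cal0sym_obj (ihom L2 L3) \<and> ev L2 L3 \<in> Hom (tensor (ihom L2 L3) L2) L3 \<and>
       (\<forall>f\<in>Hom (tensor L1 L2) L3. \<exists>!g. g \<in> Hom L1 (ihom L2 L3) \<and>
          compose (lcarrier (tensor L1 L2)) (ev L2 L3)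
            (tensor_arr L1 L2 (ihom L2 L3) L2 g (idA L2)) = f))"

text \<open>Dualizing object 2: L \<multimap> 2 \<cong> L^op, and the canonical arrow
  L \<rightarrow> (L \<multimap> 2) \<multimap> 2 (the transpose of ev \<circ> symmetry) is an isomorphism.\<close>
definition dualizing_law :: "'a lat \<Rightarrow> bool" where
  "dualizing_law L \<longleftrightarrow>
     (cal0sym_obj L \<longrightarrow>
       (\<exists>h. iso (ihom L two) (dual_lat L) h) \<and>
       (\<exists>g. g \<in> Hom L (ihom (ihom L two) two) \<and>
          compose (lcarrier (tensor L (ihom L two))) (ev (ihom L two) two)
            (tensor_arr L (ihom L two) (ihom (ihom L two) two) (ihom L two) g (idA (ihom L two)))
          = compose (lcarrier (tensor L (ihom L two))) (ev L two) (symm L (ihom L two)) \<and>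
          iso L (ihom (ihom L two) two) g))"

end

theory Submission
  imports Defs
begin

text \<open>
  An object is determined by its atoms together with its \<^emph>\<open>coatomic sets\<close>, the sets of atoms below
  a coatom or below \<open>1\<close>, and an arrow by its values on atoms: a map from atoms to atoms or \<open>0\<close>
  extends to an arrow iff preimages of coatomic sets are coatomic. In these terms the coatomic sets
  of \<open>L1 \<circledast> L2\<close> are exactly the relations all of whose one-variable fibres are coatomic; that the
  proper ones are pairwise incomparable (hence coatoms) uses that two coatoms never cover all atoms.
  So \<open>L1 \<circledast> L2\<close> represents the functions of two atoms that are arrows in each variable separately,
  and every coherence diagram can be checked on atoms. An arrow \<open>f : L \<rightarrow> M\<close> is the same as the
  relation \<open>f p \<le> c\<close> between atoms of \<open>L\<close> and coatoms of \<open>M\<close>, that is, an atom or \<open>0\<close> of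
  \<open>L \<multimap> M\<close>; an arrow on \<open>K \<circledast> L\<close> and its transpose thus carry the same ternary relation
  \<open>f (p, q) \<le> c\<close>. Finally, tensoring with a two-element lattice changes nothing, and isomorphisms
  dualize, whence \<open>L \<multimap> 2 \<cong> L\<^sup>o\<^sup>p\<close> and \<open>L \<cong> (L \<multimap> 2) \<multimap> 2\<close>.
\<close>

section \<open>Complete lattices and duality\<close>

lemma dual_lat_simps [simp]:
  shows "lcarrier (dual_lat L) = lcarrier L"
    and "lle (dual_lat L) x y \<longleftrightarrow> lle L y x"
    and "dual_lat (dual_lat L) = L"
  by (simp_all add: dual_lat_def)

lemma Join_dual [simp]: "Join (dual_lat L) = Meet L"
  and Meet_dual [simp]: "Meet (dual_lat L) = Join L"
  by (simp_all add: Meet_def fun_eq_iff)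

lemma lbot_dual [simp]: "lbot (dual_lat L) = ltop L"
  and ltop_dual [simp]: "ltop (dual_lat L) = lbot L"
  by (simp_all add: lbot_def ltop_def)

lemma atoms_dual [simp]: "atoms (dual_lat L) = coatoms L"
  and coatoms_dual [simp]: "coatoms (dual_lat L) = atoms L"
  by (simp_all add: coatoms_def)

lemma atoms_below_dual [simp]: "atoms_below (dual_lat L) = coatoms_above L"
  and coatoms_above_dual [simp]: "coatoms_above (dual_lat L) = atoms_below L"
  by (simp_all add: fun_eq_iff atoms_below_def coatoms_above_def)

lemma atomistic_dual [simp]: "atomistic (dual_lat L) \<longleftrightarrow> coatomistic L"
  and coatomistic_dual [simp]: "coatomistic (dual_lat L) \<longleftrightarrow> atomistic L"
  by (simp_all add: atomistic_def coatomistic_def)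

context
  fixes L :: "'a lat"
  assumes complete: "complete_lat L"
begin

lemma lle_refl: "x \<in> lcarrier L \<Longrightarrow> lle L x x"
  using complete by (simp add: complete_lat_def)

lemma lle_antisym: "lle L x y \<Longrightarrow> lle L y x \<Longrightarrow> x \<in> lcarrier L \<Longrightarrow> y \<in> lcarrier L \<Longrightarrow> x = y"
  using complete unfolding complete_lat_def by blast

lemma lle_trans:
  "lle L x y \<Longrightarrow> lle L y z \<Longrightarrow> x \<in> lcarrier L \<Longrightarrow> y \<in> lcarrier L \<Longrightarrow> z \<in> lcarrier L \<Longrightarrow> lle L x z"
  using complete unfolding complete_lat_def by blast

lemma is_lub_Join:
  assumes "A \<subseteq> lcarrier L" shows "is_lub L A (Join L A)"
proof -
  obtain x where x: "is_lub L A x"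
    using complete assms unfolding complete_lat_def by blast
  then have "y = x" if "is_lub L A y" for y
    using that lle_antisym unfolding is_lub_def by blast
  then show ?thesis
    unfolding Join_def using x by (metis theI)
qed

lemma Join_in_carrier: "A \<subseteq> lcarrier L \<Longrightarrow> Join L A \<in> lcarrier L"
  using is_lub_Join unfolding is_lub_def by blast

lemma Join_upper: "A \<subseteq> lcarrier L \<Longrightarrow> a \<in> A \<Longrightarrow> lle L a (Join L A)"
  using is_lub_Join unfolding is_lub_def by blast

lemma Join_le_iff:
  "A \<subseteq> lcarrier L \<Longrightarrow> y \<in> lcarrier L \<Longrightarrow> lle L (Join L A) y \<longleftrightarrow> (\<forall>a\<in>A. lle L a y)"
  using is_lub_Join lle_trans unfolding is_lub_def by blast

lemma Join_eqI: "A \<subseteq> lcarrier L \<Longrightarrow> is_lub L A x \<Longrightarrow> Join L A = x"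
  using is_lub_Join lle_antisym unfolding is_lub_def by blast

lemma Join_singleton: "x \<in> lcarrier L \<Longrightarrow> Join L {x} = x"
  using lle_refl by (auto intro: Join_eqI simp: is_lub_def)

lemma Join_pair_eq_right:
  "x \<in> lcarrier L \<Longrightarrow> y \<in> lcarrier L \<Longrightarrow> lle L x y \<Longrightarrow> Join L {x, y} = y"
  using lle_refl by (auto intro: Join_eqI simp: is_lub_def)

lemma lbot_in_carrier: "lbot L \<in> lcarrier L"
  by (simp add: lbot_def Join_in_carrier)

lemma lbot_least: "x \<in> lcarrier L \<Longrightarrow> lle L (lbot L) x"
  by (simp add: lbot_def Join_le_iff)

lemma Join_diff_lbot_cong:
  assumes "A \<subseteq> lcarrier L" "B \<subseteq> lcarrier L" "A - {lbot L} = B - {lbot L}"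
  shows "Join L A = Join L B"
proof (rule Join_eqI[OF assms(1)])
  have "(\<forall>a\<in>A. lle L a y) \<longleftrightarrow> (\<forall>a\<in>B. lle L a y)" if "y \<in> lcarrier L" for y
    using assms(3) lbot_least[OF that] by blast
  then show "is_lub L A (Join L B)"
    using is_lub_Join[OF assms(2)] unfolding is_lub_def by blast
qed

lemma complete_lat_dual [simp]: "complete_lat (dual_lat L)"
proof -
  have "is_lub (dual_lat L) A (Join L {x \<in> lcarrier L. \<forall>a\<in>A. lle L x a})"
    if "A \<subseteq> lcarrier L" for A
    using that by (auto simp: is_lub_def Join_in_carrier Join_le_iff Join_upper subset_iff)
  then show ?thesis
    unfolding complete_lat_def using lle_refl lle_antisym lle_trans by simp blast
qed

end

context
  fixes L :: "'a lat"
  assumes complete: "complete_lat L"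
begin

private lemmas dual_complete = complete_lat_dual[OF complete]

lemma Meet_in_carrier: "A \<subseteq> lcarrier L \<Longrightarrow> Meet L A \<in> lcarrier L"
  using Join_in_carrier[OF dual_complete] by simp

lemma le_Meet_iff:
  "A \<subseteq> lcarrier L \<Longrightarrow> x \<in> lcarrier L \<Longrightarrow> lle L x (Meet L A) \<longleftrightarrow> (\<forall>a\<in>A. lle L x a)"
  using Join_le_iff[OF dual_complete] by simp

lemma Meet_eqI:
  assumes "A \<subseteq> lcarrier L" "x \<in> lcarrier L"
    and "\<And>y. y \<in> lcarrier L \<Longrightarrow> lle L y x \<longleftrightarrow> (\<forall>a\<in>A. lle L y a)"
  shows "Meet L A = x"
proof -
  have "is_lub (dual_lat L) A x"
    using assms(2,3) lle_refl[OF complete] by (auto simp: is_lub_def)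
  then show ?thesis
    using Join_eqI[OF dual_complete] assms(1) by simp
qed

lemma ltop_in_carrier: "ltop L \<in> lcarrier L"
  using lbot_in_carrier[OF dual_complete] by simp

lemma ltop_greatest: "x \<in> lcarrier L \<Longrightarrow> lle L x (ltop L)"
  using lbot_least[OF dual_complete] by simp

end

lemma atom_in_carrier [simp]: "p \<in> atoms L \<Longrightarrow> p \<in> lcarrier L"
  and atom_not_lbot: "p \<in> atoms L \<Longrightarrow> p \<noteq> lbot L"
  by (simp_all add: atoms_def)

lemma coatom_in_carrier [simp]: "c \<in> coatoms L \<Longrightarrow> c \<in> lcarrier L"
  using atom_in_carrier[of c "dual_lat L"] by simp

lemma atoms_below_subset_carrier: "atoms_below L x \<subseteq> lcarrier L"
  by (auto simp: atoms_below_def)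

lemma atom_le_atom_iff:
  "complete_lat L \<Longrightarrow> p \<in> atoms L \<Longrightarrow> q \<in> atoms L \<Longrightarrow> lle L p q \<longleftrightarrow> p = q"
  using lle_refl unfolding atoms_def by auto

lemma atoms_below_atom: "complete_lat L \<Longrightarrow> p \<in> atoms L \<Longrightarrow> atoms_below L p = {p}"
  by (auto simp: atoms_below_def atom_le_atom_iff)

lemma atoms_below_ltop: "complete_lat L \<Longrightarrow> atoms_below L (ltop L) = atoms L"
  by (auto simp: atoms_below_def ltop_greatest)

lemma Join_atoms_below: "atomistic L \<Longrightarrow> x \<in> lcarrier L \<Longrightarrow> Join L (atoms_below L x) = x"
  by (simp add: atomistic_def)

lemma Meet_coatoms_above: "coatomistic L \<Longrightarrow> x \<in> lcarrier L \<Longrightarrow> Meet L (coatoms_above L x) = x"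
  by (simp add: coatomistic_def)

lemma le_iff_atoms_below:
  assumes "complete_lat L" "atomistic L" "x \<in> lcarrier L" "y \<in> lcarrier L"
  shows "lle L x y \<longleftrightarrow> atoms_below L x \<subseteq> atoms_below L y"
proof -
  have "lle L x y \<longleftrightarrow> (\<forall>p\<in>atoms_below L x. lle L p y)"
    using Join_le_iff[OF assms(1) atoms_below_subset_carrier assms(4), of x]
    by (simp add: Join_atoms_below assms)
  then show ?thesis by (auto simp: atoms_below_def)
qed

lemma le_iff_coatoms_above:
  assumes "complete_lat L" "coatomistic L" "x \<in> lcarrier L" "y \<in> lcarrier L"
  shows "lle L x y \<longleftrightarrow> coatoms_above L y \<subseteq> coatoms_above L x"
  using le_iff_atoms_below[of "dual_lat L" y x] assms by simp

lemma eq_if_same_coatoms_above: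
  assumes "coatomistic L" "x \<in> lcarrier L" "y \<in> lcarrier L"
    and "\<And>c. c \<in> coatoms L \<Longrightarrow> lle L x c \<longleftrightarrow> lle L y c"
  shows "x = y"
proof -
  have "coatoms_above L x = coatoms_above L y"
    using assms(4) by (auto simp: coatoms_above_def)
  then show ?thesis
    using Meet_coatoms_above[OF assms(1)] assms(2,3) by metis
qed

section \<open>Arrows between complete lattices\<close>

lemma
  assumes "f \<in> Hom L M"
  shows Hom_extensional: "f \<in> extensional (lcarrier L)"
    and Hom_in_carrier: "x \<in> lcarrier L \<Longrightarrow> f x \<in> lcarrier M"
    and Hom_Join: "A \<subseteq> lcarrier L \<Longrightarrow> f (Join L A) = Join M (f ` A)"
    and Hom_atom: "p \<in> atoms L \<Longrightarrow> f p \<in> atoms M \<union> {lbot M}"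
    and Hom_adj_coatom: "c \<in> coatoms M \<Longrightarrow> adj L M f c \<in> coatoms L \<union> {ltop L}"
  using assms by (auto simp: Hom_def)

lemma Hom_lbot: "f \<in> Hom L M \<Longrightarrow> f (lbot L) = lbot M"
  using Hom_Join[of f L M "{}"] by (simp add: lbot_def)

lemma Hom_atom_cases [consumes 2, case_names lbot atom]:
  assumes "f \<in> Hom L M" "p \<in> atoms L"
  obtains "f p = lbot M" | "f p \<in> atoms M" "f p \<noteq> lbot M"
  using Hom_atom[OF assms] by (auto simp: atom_not_lbot)

lemma Hom_mono:
  assumes "complete_lat L" "complete_lat M" "f \<in> Hom L M"
    and "x \<in> lcarrier L" "y \<in> lcarrier L" "lle L x y"
  shows "lle M (f x) (f y)"
proof -
  have "f y = Join M {f x, f y}"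
    using Hom_Join[OF assms(3), of "{x, y}"] Join_pair_eq_right[OF assms(1)] assms by simp
  then show ?thesis
    using Join_upper[OF assms(2), of "{f x, f y}" "f x"] Hom_in_carrier[OF assms(3)] assms by simp
qed

lemma adj_in_carrier: "complete_lat L \<Longrightarrow> adj L M f c \<in> lcarrier L"
  unfolding adj_def by (rule Join_in_carrier) auto

lemma adj_eqI:
  assumes "complete_lat L" "d \<in> lcarrier L"
    and "\<And>x. x \<in> lcarrier L \<Longrightarrow> lle M (f x) c \<longleftrightarrow> lle L x d"
  shows "adj L M f c = d"
  unfolding adj_def
  by (rule Join_eqI) (use assms lle_refl[OF assms(1,2)] in \<open>auto simp: is_lub_def\<close>)

lemma le_adj_iff:
  assumes L: "complete_lat L" and M: "complete_lat M" and f: "f \<in> Hom L M"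
    and x: "x \<in> lcarrier L" and c: "c \<in> lcarrier M"
  shows "lle L x (adj L M f c) \<longleftrightarrow> lle M (f x) c"
proof
  let ?A = "{a \<in> lcarrier L. lle M (f a) c}"
  show "lle M (f x) c \<Longrightarrow> lle L x (adj L M f c)"
    using Join_upper[OF L, of ?A x] x by (auto simp: adj_def)
  assume "lle L x (adj L M f c)"
  then have "lle M (f x) (f (adj L M f c))"
    by (rule Hom_mono[OF L M f x adj_in_carrier[OF L]])
  moreover have "lle M (f (adj L M f c)) c"
    using Hom_Join[OF f, of ?A] Join_le_iff[OF M, of "f ` ?A" c] Hom_in_carrier[OF f] c
    by (auto simp: adj_def)
  ultimately show "lle M (f x) c"
    by (rule lle_trans[OF M]) (simp_all add: Hom_in_carrier[OF f] adj_in_carrier[OF L] x c)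
qed

lemma adj_ltop:
  assumes L: "complete_lat L" and M: "complete_lat M" and f: "f \<in> Hom L M"
  shows "adj L M f (ltop M) = ltop L"
  by (rule adj_eqI[OF L]) (simp_all add: ltop_in_carrier ltop_greatest L M Hom_in_carrier[OF f])

lemma idA_Hom:
  assumes "complete_lat L" shows "idA L \<in> Hom L L"
proof -
  have "idA L ` A = A" if "A \<subseteq> lcarrier L" for A
    using that by (force simp: idA_def)
  moreover have "adj L L (idA L) c = c" if "c \<in> coatoms L" for c
    using that assms by (intro adj_eqI) (simp_all add: idA_def)
  ultimately show ?thesis
    using Join_in_carrier[OF assms] by (simp add: Hom_def) (simp add: idA_def)
qed

lemma compose_Hom:
  assumes f: "f \<in> Hom L M" and g: "g \<in> Hom M N"
    and L: "complete_lat L" and M: "complete_lat M" and N: "complete_lat N"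
  shows "compose (lcarrier L) g f \<in> Hom L N"
proof -
  have "compose (lcarrier L) g f (Join L A) = Join N (compose (lcarrier L) g f ` A)"
    if A: "A \<subseteq> lcarrier L" for A
  proof -
    have "compose (lcarrier L) g f ` A = g ` f ` A"
      using A by (force simp: compose_def image_def)
    moreover have "f ` A \<subseteq> lcarrier M"
      using A Hom_in_carrier[OF f] by blast
    ultimately show ?thesis
      using Join_in_carrier[OF L A] by (simp add: compose_def Hom_Join[OF f A] Hom_Join[OF g])
  qed
  moreover have "compose (lcarrier L) g f p \<in> atoms N \<union> {lbot N}" if p: "p \<in> atoms L" for p
    using Hom_atom[OF g, of "f p"] Hom_lbot[OF g]
    by (cases rule: Hom_atom_cases[OF f p]) (simp_all add: compose_def p)
  moreover have "adj L N (compose (lcarrier L) g f) c \<in> coatoms L \<union> {ltop L}"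
    if c: "c \<in> coatoms N" for c
  proof -
    have "adj L N (compose (lcarrier L) g f) c = adj L M f (adj M N g c)"
      by (rule adj_eqI[OF L]) (simp_all add: compose_def le_adj_iff[OF L M f] le_adj_iff[OF M N g]
          Hom_in_carrier[OF f] adj_in_carrier L M c)
    then show ?thesis
      using Hom_adj_coatom[OF f, of "adj M N g c"] Hom_adj_coatom[OF g c] adj_ltop[OF L M f] by auto
  qed
  ultimately show ?thesis
    using Hom_in_carrier[OF f] Hom_in_carrier[OF g] by (auto simp: Hom_def compose_def)
qed

lemma adj_Hom_dual:
  assumes f: "f \<in> Hom L M" and L: "complete_lat L" and M: "complete_lat M"
  shows "restrict (adj L M f) (lcarrier M) \<in> Hom (dual_lat M) (dual_lat L)" (is "?f' \<in> _")
proof -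
  have "adj L M f (Meet M A) = Meet L (adj L M f ` A)" if A: "A \<subseteq> lcarrier M" for A
  proof (rule adj_eqI[OF L])
    have B: "adj L M f ` A \<subseteq> lcarrier L"
      by (simp add: image_subset_iff adj_in_carrier[OF L])
    then show "Meet L (adj L M f ` A) \<in> lcarrier L"
      by (rule Meet_in_carrier[OF L])
    show "lle M (f x) (Meet M A) \<longleftrightarrow> lle L x (Meet L (adj L M f ` A))" if x: "x \<in> lcarrier L" for x
      using A le_adj_iff[OF L M f x]
      by (auto simp: le_Meet_iff[OF M A Hom_in_carrier[OF f x]] le_Meet_iff[OF L B x] subset_iff)
  qed
  moreover have "?f' ` A = adj L M f ` A" if "A \<subseteq> lcarrier M" for A
    using that by auto
  moreover have "adj (dual_lat M) (dual_lat L) ?f' p \<in> atoms M \<union> {lbot M}" if p: "p \<in> atoms L" for p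
  proof -
    have "adj (dual_lat M) (dual_lat L) ?f' p = f p"
      using p by (intro adj_eqI) (simp_all add: M Hom_in_carrier[OF f] le_adj_iff[OF L M f])
    then show ?thesis
      using Hom_atom[OF f p] by simp
  qed
  ultimately show ?thesis
    using Hom_adj_coatom[OF f] by (auto simp: Hom_def Meet_in_carrier M adj_in_carrier L)
qed

lemma isoI:
  assumes "f \<in> Hom L M" "g \<in> Hom M L"
    and "\<And>x. x \<in> lcarrier L \<Longrightarrow> g (f x) = x" "\<And>y. y \<in> lcarrier M \<Longrightarrow> f (g y) = y"
  shows "iso L M f"
proof -
  have "compose (lcarrier L) g f = idA L" "compose (lcarrier M) f g = idA M"
    using assms(3,4) by (auto simp: compose_def idA_def fun_eq_iff)
  with assms(1,2) show ?thesis by (auto simp: iso_def)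
qed

lemma isoE:
  assumes "iso L M f"
  obtains g where "f \<in> Hom L M" "g \<in> Hom M L"
    "\<forall>x\<in>lcarrier L. g (f x) = x" "\<forall>y\<in>lcarrier M. f (g y) = y"
proof -
  obtain g where g: "f \<in> Hom L M" "g \<in> Hom M L"
    and "compose (lcarrier L) g f = idA L" "compose (lcarrier M) f g = idA M"
    using assms by (auto simp: iso_def)
  then have "\<forall>x\<in>lcarrier L. g (f x) = x" "\<forall>y\<in>lcarrier M. f (g y) = y"
    by (metis compose_eq idA_def restrict_apply')+
  with g show thesis by (rule that)
qed

lemma iso_compose:
  assumes f: "iso L M f" and g: "iso M N g"
    and "complete_lat L" "complete_lat M" "complete_lat N"
  shows "iso L N (compose (lcarrier L) g f)"
proof -
  obtain f' where f': "f \<in> Hom L M" "f' \<in> Hom M L"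
    "\<forall>x\<in>lcarrier L. f' (f x) = x" "\<forall>y\<in>lcarrier M. f (f' y) = y"
    using f by (rule isoE)
  obtain g' where g': "g \<in> Hom M N" "g' \<in> Hom N M"
    "\<forall>x\<in>lcarrier M. g' (g x) = x" "\<forall>y\<in>lcarrier N. g (g' y) = y"
    using g by (rule isoE)
  show ?thesis
    by (rule isoI[OF compose_Hom[OF f'(1) g'(1)] compose_Hom[OF g'(2) f'(2)]])
      (simp_all add: assms compose_def f' g' Hom_in_carrier[OF f'(1)] Hom_in_carrier[OF f'(2)]
        Hom_in_carrier[OF g'(1)] Hom_in_carrier[OF g'(2)])
qed

lemma iso_le_iff:
  assumes f: "iso L M f" and L: "complete_lat L" and M: "complete_lat M"
    and x: "x \<in> lcarrier L" and y: "y \<in> lcarrier L"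
  shows "lle M (f x) (f y) \<longleftrightarrow> lle L x y"
proof -
  obtain g where g: "f \<in> Hom L M" "g \<in> Hom M L" "\<forall>x\<in>lcarrier L. g (f x) = x"
    using f by (rule isoE)
  then show ?thesis
    using Hom_mono[OF L M g(1) x y] Hom_mono[OF M L g(2), of "f x" "f y"] x y
    by (auto simp: Hom_in_carrier[OF g(1)])
qed

text \<open>The inverse of an isomorphism is also its adjoint.\<close>

lemma inverse_Hom_dual:
  assumes f: "f \<in> Hom L M" and g: "g \<in> Hom M L" and L: "complete_lat L" and M: "complete_lat M"
    and gf: "\<forall>x\<in>lcarrier L. g (f x) = x" and fg: "\<forall>y\<in>lcarrier M. f (g y) = y"
  shows "g \<in> Hom (dual_lat M) (dual_lat L)"
proof -
  have "iso L M f"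
    using gf fg by (intro isoI[OF f g]) simp_all
  then have "lle M (f x) y \<longleftrightarrow> lle L x (g y)" if "x \<in> lcarrier L" "y \<in> lcarrier M" for x y
    using iso_le_iff[of L M f x "g y"] that by (simp add: L M fg Hom_in_carrier[OF g])
  then have "adj L M f y = g y" if "y \<in> lcarrier M" for y
    using that by (intro adj_eqI[OF L]) (simp_all add: Hom_in_carrier[OF g])
  then have "restrict (adj L M f) (lcarrier M) = restrict g (lcarrier M)"
    by (rule restrict_ext)
  also have "\<dots> = g"
    using Hom_extensional[OF g] by (simp add: extensional_restrict)
  finally show ?thesis
    using adj_Hom_dual[OF f L M] by simp
qed

lemma iso_dual:
  assumes f: "iso L M f" and L: "complete_lat L" and M: "complete_lat M"
  shows "iso (dual_lat L) (dual_lat M) f"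
proof -
  obtain g where g: "f \<in> Hom L M" "g \<in> Hom M L"
    "\<forall>x\<in>lcarrier L. g (f x) = x" "\<forall>y\<in>lcarrier M. f (g y) = y"
    using f by (rule isoE)
  have "f \<in> Hom (dual_lat L) (dual_lat M)" "g \<in> Hom (dual_lat M) (dual_lat L)"
    by (rule inverse_Hom_dual[OF g(2,1) M L g(4,3)], rule inverse_Hom_dual[OF g(1,2) L M g(3,4)])
  then show ?thesis
    by (rule isoI) (simp_all add: g)
qed

section \<open>Coatomic sets\<close>

lemma cal0sym_obj_iff_separated:
  "cal0sym_obj L \<longleftrightarrow> complete_lat L \<and> atomistic L \<and> coatomistic L \<and>
     (\<forall>c\<in>coatoms L. \<forall>d\<in>coatoms L. \<exists>p\<in>atoms L. \<not> lle L p c \<and> \<not> lle L p d) \<and>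
     (\<forall>p\<in>atoms L. \<forall>q\<in>atoms L. \<exists>c\<in>coatoms L. \<not> lle L p c \<and> \<not> lle L q c)"
proof -
  have "atoms_below L c \<union> atoms_below L d \<noteq> atoms L \<longleftrightarrow>
      (\<exists>p\<in>atoms L. \<not> lle L p c \<and> \<not> lle L p d)" for c d
    by (auto simp: atoms_below_def)
  moreover have "coatoms_above L p \<union> coatoms_above L q \<noteq> coatoms L \<longleftrightarrow>
      (\<exists>c\<in>coatoms L. \<not> lle L p c \<and> \<not> lle L q c)" for p q
    by (auto simp: coatoms_above_def)
  ultimately show ?thesis
    by (simp add: cal0sym_obj_def)
qed

lemma cal0sym_obj_complete [simp]: "cal0sym_obj L \<Longrightarrow> complete_lat L"
  and cal0sym_obj_atomistic [simp]: "cal0sym_obj L \<Longrightarrow> atomistic L"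
  and cal0sym_obj_coatomistic [simp]: "cal0sym_obj L \<Longrightarrow> coatomistic L"
  by (simp_all add: cal0sym_obj_def)

lemma cal0sym_obj_dual [simp]: "cal0sym_obj L \<Longrightarrow> cal0sym_obj (dual_lat L)"
  unfolding cal0sym_obj_iff_separated by simp

lemma coatoms_separated:
  "cal0sym_obj L \<Longrightarrow> c \<in> coatoms L \<Longrightarrow> d \<in> coatoms L \<Longrightarrow> \<exists>p\<in>atoms L. \<not> lle L p c \<and> \<not> lle L p d"
  unfolding cal0sym_obj_iff_separated by simp

lemma atoms_separated:
  "cal0sym_obj L \<Longrightarrow> p \<in> atoms L \<Longrightarrow> q \<in> atoms L \<Longrightarrow> \<exists>c\<in>coatoms L. \<not> lle L p c \<and> \<not> lle L q c"
  unfolding cal0sym_obj_iff_separated by simp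

lemma coatom_between_atoms:
  assumes "complete_lat L" "coatomistic L" "p \<in> atoms L" "q \<in> atoms L" "p \<noteq> q"
  shows "\<exists>c\<in>coatoms L. lle L q c \<and> \<not> lle L p c"
  using le_iff_coatoms_above[of L p q] atom_le_atom_iff[of L p q] assms
  by (auto simp: coatoms_above_def)

definition coatomic_sets :: "'a lat \<Rightarrow> 'a set set" where
  "coatomic_sets L = Cl L (coatoms L \<union> {ltop L})"

lemma coatomic_setsI: "d \<in> coatoms L \<union> {ltop L} \<Longrightarrow> atoms_below L d \<in> coatomic_sets L"
  unfolding coatomic_sets_def Cl_def by (rule imageI)

lemma coatomic_setsE:
  assumes "S \<in> coatomic_sets L" "complete_lat L"
  obtains d where "d \<in> coatoms L \<union> {ltop L}" "d \<in> lcarrier L" "S = atoms_below L d"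
proof -
  obtain d where "d \<in> coatoms L \<union> {ltop L}" "S = atoms_below L d"
    using assms(1) unfolding coatomic_sets_def Cl_def by blast
  with assms(2) show thesis
    by (intro that[of d]) (auto simp: ltop_in_carrier)
qed

lemma coatomic_sets_iff:
  "complete_lat L \<Longrightarrow> S \<in> coatomic_sets L \<longleftrightarrow> S = atoms L \<or> (\<exists>c\<in>coatoms L. S = atoms_below L c)"
  by (auto simp: coatomic_sets_def Cl_def atoms_below_ltop)

lemma atoms_coatomic [simp]: "complete_lat L \<Longrightarrow> atoms L \<in> coatomic_sets L"
  by (simp add: coatomic_sets_iff)

lemma atoms_below_coatom_coatomic:
  "c \<in> coatoms L \<Longrightarrow> {p \<in> atoms L. lle L p c} \<in> coatomic_sets L"
  using coatomic_setsI[of c L] by (simp add: atoms_below_def)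

lemma coatomic_sets_dualE:
  assumes "S \<in> coatomic_sets (dual_lat L)" "complete_lat L"
  obtains a where "a \<in> atoms L \<union> {lbot L}" "a \<in> lcarrier L" "S = coatoms_above L a"
  by (rule coatomic_setsE[OF assms(1) complete_lat_dual[OF assms(2)]]) (rule that, simp_all)

lemma coatoms_above_atom_coatomic:
  assumes "a \<in> atoms L \<union> {lbot L}"
  shows "{c \<in> coatoms L. lle L a c} \<in> coatomic_sets (dual_lat L)"
proof -
  have "{c \<in> coatoms L. lle L a c} = atoms_below (dual_lat L) a"
    by (simp add: coatoms_above_def)
  then show ?thesis
    using coatomic_setsI[of a "dual_lat L"] assms by simp
qed

lemma coatomic_sets_incomparable:
  assumes L: "cal0sym_obj L" and "S \<in> coatomic_sets L" "S' \<in> coatomic_sets L"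
    and "S \<subseteq> S'" "S' \<noteq> atoms L"
  shows "S = S'"
proof (cases "S = atoms L")
  case True
  have "S' \<subseteq> atoms L"
    using assms(3) L by (auto simp: coatomic_sets_iff atoms_below_def)
  with True assms(4) show ?thesis by simp
next
  case False
  then obtain c d where cd: "c \<in> coatoms L" "S = atoms_below L c"
    "d \<in> coatoms L" "S' = atoms_below L d"
    using assms by (auto simp: coatomic_sets_iff)
  then have "lle L c d"
    using assms(4) by (simp add: le_iff_atoms_below L)
  then have "c = d"
    using atom_le_atom_iff[of "dual_lat L" d c] cd L by simp
  with cd show ?thesis by simp
qed

lemma coatomic_sets_separated:
  assumes "cal0sym_obj L" "S \<in> coatomic_sets L" "S' \<in> coatomic_sets L" "S \<noteq> atoms L" "S' \<noteq> atoms L"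
  shows "\<exists>r\<in>atoms L. r \<notin> S \<and> r \<notin> S'"
proof -
  obtain c d where "c \<in> coatoms L" "S = atoms_below L c" "d \<in> coatoms L" "S' = atoms_below L d"
    using assms by (auto simp: coatomic_sets_iff)
  then show ?thesis
    using coatoms_separated[OF assms(1), of c d] by (auto simp: atoms_below_def)
qed

lemma coatomic_sets_one_atom:
  assumes "cal0sym_obj L" "atoms L = {u}"
  shows "{p \<in> atoms L. P p} \<in> coatomic_sets L"
proof (cases "P u")
  case True
  then have "{p \<in> atoms L. P p} = atoms L"
    using assms(2) by auto
  with assms(1) show ?thesis by simp
next
  case False
  obtain c where "c \<in> coatoms L" "\<not> lle L u c"
    using atoms_separated[of L u u] assms by auto
  with atoms_below_coatom_coatomic[of c L] show ?thesis
    using False assms by (simp cong: conj_cong)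
qed

section \<open>Arrows as maps on atoms\<close>

definition atom_map :: "'a lat \<Rightarrow> 'b lat \<Rightarrow> ('a \<Rightarrow> 'b) \<Rightarrow> bool" where
  "atom_map L M \<phi> \<longleftrightarrow> (\<forall>p\<in>atoms L. \<phi> p \<in> atoms M \<union> {lbot M}) \<and>
     (\<forall>c\<in>coatoms M. {p \<in> atoms L. lle M (\<phi> p) c} \<in> coatomic_sets L)"

definition atom_extension :: "'a lat \<Rightarrow> 'b lat \<Rightarrow> ('a \<Rightarrow> 'b) \<Rightarrow> 'a \<Rightarrow> 'b" where
  "atom_extension L M \<phi> = restrict (\<lambda>x. Join M (\<phi> ` atoms_below L x)) (lcarrier L)"

lemma atom_map_cong:
  assumes "atom_map L M \<phi>" "\<And>p. p \<in> atoms L \<Longrightarrow> \<phi> p = \<psi> p"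
  shows "atom_map L M \<psi>"
  using assms by (simp add: atom_map_def cong: conj_cong)

lemma atom_map_in_carrier: "atom_map L M \<phi> \<Longrightarrow> complete_lat M \<Longrightarrow> p \<in> atoms L \<Longrightarrow> \<phi> p \<in> lcarrier M"
  using lbot_in_carrier by (fastforce simp: atom_map_def)

lemma atom_map_id: "atom_map L L (\<lambda>p. p)"
  by (simp add: atom_map_def atoms_below_coatom_coatomic)

lemma atom_map_const_lbot: "complete_lat L \<Longrightarrow> complete_lat M \<Longrightarrow> atom_map L M (\<lambda>p. lbot M)"
  by (simp add: atom_map_def lbot_least)

lemma atom_map_from_one_atom:
  "cal0sym_obj L \<Longrightarrow> atoms L = {u} \<Longrightarrow> a \<in> atoms M \<union> {lbot M} \<Longrightarrow> atom_map L M (\<lambda>p. a)"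
  using coatomic_sets_one_atom[of L u] by (simp add: atom_map_def)

lemma atom_map_preimage_coatomic:
  assumes "complete_lat L" "complete_lat M" "atom_map L M \<phi>" "S \<in> coatomic_sets M"
  shows "{p \<in> atoms L. \<phi> p = lbot M \<or> \<phi> p \<in> S} \<in> coatomic_sets L"
proof -
  obtain d where d: "d \<in> coatoms M \<union> {ltop M}" "d \<in> lcarrier M" "S = atoms_below M d"
    using assms(4,2) by (rule coatomic_setsE)
  have "{p \<in> atoms L. \<phi> p = lbot M \<or> \<phi> p \<in> S} = {p \<in> atoms L. lle M (\<phi> p) d}"
    using assms(2,3) d(2) by (auto simp: d(3) atoms_below_def atom_map_def lbot_least)
  also have "\<dots> \<in> coatomic_sets L"
  proof (cases "d \<in> coatoms M")
    case True
    with assms(3) show ?thesis by (simp add: atom_map_def)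
  next
    case False
    with d(1) have "{p \<in> atoms L. lle M (\<phi> p) d} = atoms L"
      using assms(2,3) by (auto simp: ltop_greatest atom_map_in_carrier)
    with assms(1) show ?thesis by simp
  qed
  finally show ?thesis .
qed

lemma atom_map_strict_compose:
  assumes "complete_lat L" "complete_lat M" "complete_lat N"
    and \<phi>: "atom_map L M \<phi>" and \<psi>: "atom_map M N \<psi>"
  shows "atom_map L N (\<lambda>p. if \<phi> p = lbot M then lbot N else \<psi> (\<phi> p))" (is "atom_map L N ?\<psi>\<phi>")
proof -
  have "{p \<in> atoms L. lle N (?\<psi>\<phi> p) c} \<in> coatomic_sets L" if c: "c \<in> coatoms N" for c
  proof -
    have "{p \<in> atoms L. lle N (?\<psi>\<phi> p) c}
      = {p \<in> atoms L. \<phi> p = lbot M \<or> \<phi> p \<in> {q \<in> atoms M. lle N (\<psi> q) c}}"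
      using \<phi> c assms(3) by (auto simp: atom_map_def lbot_least)
    also have "\<dots> \<in> coatomic_sets L"
      using \<psi> c by (intro atom_map_preimage_coatomic[OF assms(1,2) \<phi>]) (simp add: atom_map_def)
    finally show ?thesis .
  qed
  then show ?thesis
    using \<phi> \<psi> by (auto simp: atom_map_def)
qed

lemma atom_map_compose:
  assumes "complete_lat L" "complete_lat M" "complete_lat N" "atom_map L M \<phi>" "atom_map M N \<psi>"
    and "\<And>p. p \<in> atoms L \<Longrightarrow> \<phi> p \<in> atoms M"
  shows "atom_map L N (\<lambda>p. \<psi> (\<phi> p))"
  by (rule atom_map_cong[OF atom_map_strict_compose[OF assms(1-5)]])
    (simp add: assms(6) atom_not_lbot)

lemma Hom_atom_map:
  assumes L: "complete_lat L" and M: "complete_lat M" and f: "f \<in> Hom L M"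
  shows "atom_map L M f"
proof -
  have "{p \<in> atoms L. lle M (f p) c} \<in> coatomic_sets L" if c: "c \<in> coatoms M" for c
  proof -
    have "{p \<in> atoms L. lle M (f p) c} = atoms_below L (adj L M f c)"
      using c by (auto simp: atoms_below_def le_adj_iff[OF L M f])
    then show ?thesis
      by (simp only: coatomic_setsI[OF Hom_adj_coatom[OF f c]])
  qed
  then show ?thesis
    using Hom_atom[OF f] by (simp add: atom_map_def)
qed

lemma Hom_eqI:
  assumes L: "atomistic L" and f: "f \<in> Hom L M" and g: "g \<in> Hom L M"
    and eq: "\<And>p. p \<in> atoms L \<Longrightarrow> f p = g p"
  shows "f = g"
proof (rule extensionalityI[OF Hom_extensional[OF f] Hom_extensional[OF g]])
  fix x assume x: "x \<in> lcarrier L"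
  have "f (Join L (atoms_below L x)) = g (Join L (atoms_below L x))"
    unfolding Hom_Join[OF f atoms_below_subset_carrier] Hom_Join[OF g atoms_below_subset_carrier]
    by (rule arg_cong[of _ _ "Join M"], rule image_cong) (simp_all add: eq atoms_below_def)
  with x show "f x = g x"
    by (simp add: Join_atoms_below[OF L])
qed

lemma iso_atomsI:
  assumes L: "complete_lat L" "atomistic L" and M: "complete_lat M" "atomistic M"
    and f: "f \<in> Hom L M" and g: "g \<in> Hom M L"
    and gf: "\<And>p. p \<in> atoms L \<Longrightarrow> g (f p) = p" and fg: "\<And>q. q \<in> atoms M \<Longrightarrow> f (g q) = q"
  shows "iso L M f"
proof -
  have "compose (lcarrier L) g f = idA L"
    by (rule Hom_eqI[OF L(2) compose_Hom[OF f g L(1) M(1) L(1)] idA_Hom[OF L(1)]])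
      (simp add: gf compose_def idA_def)
  moreover have "compose (lcarrier M) f g = idA M"
    by (rule Hom_eqI[OF M(2) compose_Hom[OF g f M(1) L(1) M(1)] idA_Hom[OF M(1)]])
      (simp add: fg compose_def idA_def)
  ultimately show ?thesis
    using f g by (auto simp: iso_def)
qed

context
  fixes L :: "'a lat" and M :: "'b lat" and \<phi> :: "'a \<Rightarrow> 'b"
  assumes L: "complete_lat L" "atomistic L" and M: "complete_lat M" "coatomistic M"
    and \<phi>: "atom_map L M \<phi>"
begin

lemma image_atoms_below_subset_carrier: "\<phi> ` atoms_below L x \<subseteq> lcarrier M"
  using atom_map_in_carrier[OF \<phi> M(1)] by (auto simp: atoms_below_def)

lemma atom_extension_atom: "p \<in> atoms L \<Longrightarrow> atom_extension L M \<phi> p = \<phi> p"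
  using atom_map_in_carrier[OF \<phi> M(1)]
  by (simp add: atom_extension_def atoms_below_atom L Join_singleton M)

lemma atom_extension_in_carrier: "x \<in> lcarrier L \<Longrightarrow> atom_extension L M \<phi> x \<in> lcarrier M"
  by (simp add: atom_extension_def Join_in_carrier[OF M(1) image_atoms_below_subset_carrier])

lemma atom_extension_le_coatom:
  assumes c: "c \<in> coatoms M"
  obtains d where "d \<in> coatoms L \<union> {ltop L}" "d \<in> lcarrier L"
    "\<And>x. x \<in> lcarrier L \<Longrightarrow> lle M (atom_extension L M \<phi> x) c \<longleftrightarrow> lle L x d"
proof -
  have "{p \<in> atoms L. lle M (\<phi> p) c} \<in> coatomic_sets L"
    using \<phi> c by (simp add: atom_map_def)
  then obtain d where d: "d \<in> coatoms L \<union> {ltop L}" "d \<in> lcarrier L"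
    "{p \<in> atoms L. lle M (\<phi> p) c} = atoms_below L d"
    by (rule coatomic_setsE[OF _ L(1)])
  have "lle M (atom_extension L M \<phi> x) c \<longleftrightarrow> lle L x d" if x: "x \<in> lcarrier L" for x
  proof -
    have "lle M (atom_extension L M \<phi> x) c \<longleftrightarrow> atoms_below L x \<subseteq> {p \<in> atoms L. lle M (\<phi> p) c}"
      using x c Join_le_iff[OF M(1) image_atoms_below_subset_carrier, of c x]
      by (auto simp: atom_extension_def atoms_below_def)
    then show ?thesis
      by (simp add: d(3) le_iff_atoms_below[OF L x d(2)])
  qed
  with d(1,2) show thesis by (rule that)
qed

lemma atom_extension_Join:
  assumes A: "A \<subseteq> lcarrier L"
  shows "atom_extension L M \<phi> (Join L A) = Join M (atom_extension L M \<phi> ` A)"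
proof (rule eq_if_same_coatoms_above[OF M(2)])
  let ?F = "atom_extension L M \<phi>"
  have FA: "?F ` A \<subseteq> lcarrier M"
    using A atom_extension_in_carrier by blast
  show "?F (Join L A) \<in> lcarrier M"
    by (rule atom_extension_in_carrier[OF Join_in_carrier[OF L(1) A]])
  show "Join M (?F ` A) \<in> lcarrier M"
    by (rule Join_in_carrier[OF M(1) FA])
  fix c assume c: "c \<in> coatoms M"
  obtain d where d: "d \<in> lcarrier L" "\<And>x. x \<in> lcarrier L \<Longrightarrow> lle M (?F x) c \<longleftrightarrow> lle L x d"
    using atom_extension_le_coatom[OF c] by metis
  have "lle M (?F (Join L A)) c \<longleftrightarrow> (\<forall>a\<in>A. lle M (?F a) c)"
    using d(2) A by (simp add: Join_in_carrier[OF L(1) A] Join_le_iff[OF L(1) A d(1)] subset_iff)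
  then show "lle M (?F (Join L A)) c \<longleftrightarrow> lle M (Join M (?F ` A)) c"
    using c by (simp add: Join_le_iff[OF M(1) FA])
qed

lemma atom_extension_Hom: "atom_extension L M \<phi> \<in> Hom L M"
proof -
  have "adj L M (atom_extension L M \<phi>) c \<in> coatoms L \<union> {ltop L}" if c: "c \<in> coatoms M" for c
    using atom_extension_le_coatom[OF c] adj_eqI[OF L(1)] by metis
  moreover have "\<phi> p \<in> atoms M \<union> {lbot M}" if "p \<in> atoms L" for p
    using that \<phi> by (simp add: atom_map_def)
  ultimately show ?thesis
    using atom_extension_Join atom_extension_in_carrier
    by (auto simp: Hom_def atom_extension_atom) (simp add: atom_extension_def)
qed

end

section \<open>The tensor product of two objects\<close>

definition fibrewise_coatomic :: "'a lat \<Rightarrow> 'b lat \<Rightarrow> ('a \<times> 'b) set \<Rightarrow> bool" where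
  "fibrewise_coatomic L1 L2 R \<longleftrightarrow>
     (\<forall>p2\<in>atoms L2. {p1 \<in> atoms L1. (p1, p2) \<in> R} \<in> coatomic_sets L1) \<and>
     (\<forall>p1\<in>atoms L1. {p2 \<in> atoms L2. (p1, p2) \<in> R} \<in> coatomic_sets L2)"

lemma tsr_gen_iff:
  "R \<in> tsr_gen L1 L2 \<longleftrightarrow> R \<subset> atoms L1 \<times> atoms L2 \<and> fibrewise_coatomic L1 L2 R"
proof (cases "R \<subset> atoms L1 \<times> atoms L2")
  case True
  then have "{q1. (q1, p2) \<in> R} = {q1 \<in> atoms L1. (q1, p2) \<in> R}"
    "{q2. (p1, q2) \<in> R} = {q2 \<in> atoms L2. (p1, q2) \<in> R}" for p1 p2
    by auto
  moreover have "atoms L1 \<noteq> {}" "atoms L2 \<noteq> {}"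
    using True by auto
  ultimately show ?thesis
    using True unfolding tsr_gen_def fibrewise_coatomic_def coatomic_sets_def by auto
next
  case False
  then show ?thesis by (simp add: tsr_gen_def)
qed

lemma tsr_gen_subset: "R \<in> tsr_gen L1 L2 \<Longrightarrow> R \<subseteq> atoms L1 \<times> atoms L2"
  by (auto simp: tsr_gen_iff)

lemma tsr_gen_fibres:
  assumes "R \<in> tsr_gen L1 L2"
  shows "q \<in> atoms L2 \<Longrightarrow> {p \<in> atoms L1. (p, q) \<in> R} \<in> coatomic_sets L1"
    and "p \<in> atoms L1 \<Longrightarrow> {q \<in> atoms L2. (p, q) \<in> R} \<in> coatomic_sets L2"
  using assms by (simp_all add: tsr_gen_iff fibrewise_coatomic_def)

lemma tsr_gen_avoids:
  assumes "R \<in> tsr_gen L1 L2"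
  obtains p q where "p \<in> atoms L1" "q \<in> atoms L2" "(p, q) \<notin> R"
  using assms by (auto simp: tsr_gen_iff)

lemma fibrewise_coatomic_iff_tsr_gen:
  assumes "complete_lat L1" "complete_lat L2" "R \<subseteq> atoms L1 \<times> atoms L2"
  shows "fibrewise_coatomic L1 L2 R \<longleftrightarrow> R = atoms L1 \<times> atoms L2 \<or> R \<in> tsr_gen L1 L2"
  using assms by (auto simp: tsr_gen_iff fibrewise_coatomic_def)

lemma lle_tensor [simp]: "lle (tensor L1 L2) X Y \<longleftrightarrow> X \<subseteq> Y"
  by (simp add: tensor_def)

lemma tensor_carrier_iff:
  "X \<in> lcarrier (tensor L1 L2) \<longleftrightarrow> X \<subseteq> atoms L1 \<times> atoms L2 \<and>
     (\<forall>z \<in> atoms L1 \<times> atoms L2 - X. \<exists>R\<in>tsr_gen L1 L2. X \<subseteq> R \<and> z \<notin> R)"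
  (is "_ \<longleftrightarrow> ?separated")
proof
  assume "X \<in> lcarrier (tensor L1 L2)"
  then obtain \<omega> where "\<omega> \<subseteq> tsr_gen L1 L2 \<union> {atoms L1 \<times> atoms L2}"
    "X = (atoms L1 \<times> atoms L2) \<inter> \<Inter>\<omega>"
    by (auto simp: tensor_def)
  then show ?separated by blast
next
  assume ?separated
  then have "X = (atoms L1 \<times> atoms L2) \<inter> \<Inter>{R \<in> tsr_gen L1 L2. X \<subseteq> R}"
    by blast
  moreover have "{R \<in> tsr_gen L1 L2. X \<subseteq> R} \<subseteq> tsr_gen L1 L2 \<union> {atoms L1 \<times> atoms L2}"
    by blast
  ultimately show "X \<in> lcarrier (tensor L1 L2)"
    unfolding tensor_def by auto
qed

lemma tensor_carrier_subset: "X \<in> lcarrier (tensor L1 L2) \<Longrightarrow> X \<subseteq> atoms L1 \<times> atoms L2"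
  by (simp add: tensor_carrier_iff)

lemma tsr_gen_in_carrier: "R \<in> tsr_gen L1 L2 \<Longrightarrow> R \<in> lcarrier (tensor L1 L2)"
  by (auto simp: tensor_carrier_iff tsr_gen_iff)

lemma full_in_tensor_carrier: "atoms L1 \<times> atoms L2 \<in> lcarrier (tensor L1 L2)"
  by (simp add: tensor_carrier_iff)

lemma tensor_carrier_le_tsr_gen:
  assumes "X \<in> lcarrier (tensor L1 L2)" "X \<noteq> atoms L1 \<times> atoms L2"
  obtains R where "R \<in> tsr_gen L1 L2" "X \<subseteq> R"
  using assms unfolding tensor_carrier_iff by blast

lemma complete_lat_tensor [simp]: "complete_lat (tensor L1 L2)"
proof -
  have "is_lub (tensor L1 L2) A ((atoms L1 \<times> atoms L2) \<inter> \<Inter>{R \<in> tsr_gen L1 L2. \<Union>A \<subseteq> R})"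
    (is "is_lub _ _ ?J") if A: "A \<subseteq> lcarrier (tensor L1 L2)" for A
  proof -
    have "\<Union>A \<subseteq> atoms L1 \<times> atoms L2"
      using A tensor_carrier_subset by blast
    moreover have "?J \<in> lcarrier (tensor L1 L2)"
      unfolding tensor_carrier_iff by blast
    moreover have "?J \<subseteq> Y" if Y: "Y \<in> lcarrier (tensor L1 L2)" "\<Union>A \<subseteq> Y" for Y
    proof (rule subsetI, rule ccontr)
      fix z assume "z \<in> ?J" "z \<notin> Y"
      moreover from this Y(1) obtain R where "R \<in> tsr_gen L1 L2" "Y \<subseteq> R" "z \<notin> R"
        unfolding tensor_carrier_iff by blast
      ultimately show False
        using Y(2) by blast
    qed
    ultimately show ?thesis
      by (auto simp: is_lub_def Sup_le_iff)
  qed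
  then show ?thesis
    unfolding complete_lat_def by auto
qed

lemma ltop_tensor [simp]: "ltop (tensor L1 L2) = atoms L1 \<times> atoms L2"
  unfolding ltop_def
  by (rule Meet_eqI) (simp_all add: full_in_tensor_carrier tensor_carrier_subset)

definition coatom_cross :: "'a lat \<Rightarrow> 'b lat \<Rightarrow> 'a \<Rightarrow> 'b \<Rightarrow> ('a \<times> 'b) set" where
  "coatom_cross L1 L2 c d = {(p, q) \<in> atoms L1 \<times> atoms L2. lle L1 p c \<or> lle L2 q d}"

lemma in_coatom_cross_iff [simp]:
  "(p, q) \<in> coatom_cross L1 L2 c d \<longleftrightarrow> p \<in> atoms L1 \<and> q \<in> atoms L2 \<and> (lle L1 p c \<or> lle L2 q d)"
  by (simp add: coatom_cross_def)

context
  fixes L1 :: "'a lat" and L2 :: "'b lat"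
  assumes L1: "cal0sym_obj L1" and L2: "cal0sym_obj L2"
begin

lemma coatom_cross_tsr_gen:
  assumes c: "c \<in> coatoms L1" and d: "d \<in> coatoms L2"
  shows "coatom_cross L1 L2 c d \<in> tsr_gen L1 L2"
proof -
  obtain p q where "p \<in> atoms L1" "\<not> lle L1 p c" "q \<in> atoms L2" "\<not> lle L2 q d"
    using coatoms_separated[OF L1 c c] coatoms_separated[OF L2 d d] by blast
  then have "coatom_cross L1 L2 c d \<subset> atoms L1 \<times> atoms L2"
    by (auto simp: coatom_cross_def)
  moreover have "{p \<in> atoms L1. lle L1 p c \<or> b} \<in> coatomic_sets L1"
    "{q \<in> atoms L2. b \<or> lle L2 q d} \<in> coatomic_sets L2" for b
    using c d L1 L2 by (cases b; simp add: atoms_below_coatom_coatomic)+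
  ultimately show ?thesis
    by (simp add: tsr_gen_iff fibrewise_coatomic_def coatom_cross_def)
qed

lemma empty_in_tensor_carrier: "{} \<in> lcarrier (tensor L1 L2)"
  unfolding tensor_carrier_iff
proof (intro conjI ballI)
  fix z assume "z \<in> atoms L1 \<times> atoms L2 - {}"
  then obtain p q where z: "z = (p, q)" "p \<in> atoms L1" "q \<in> atoms L2"
    by auto
  obtain c d where "c \<in> coatoms L1" "\<not> lle L1 p c" "d \<in> coatoms L2" "\<not> lle L2 q d"
    using atoms_separated[OF L1 z(2,2)] atoms_separated[OF L2 z(3,3)] by blast
  then show "\<exists>R\<in>tsr_gen L1 L2. {} \<subseteq> R \<and> z \<notin> R"
    by (intro bexI[of _ "coatom_cross L1 L2 c d"]) (simp_all add: z coatom_cross_tsr_gen)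
qed simp

lemma singleton_in_tensor_carrier:
  assumes z: "z \<in> atoms L1 \<times> atoms L2"
  shows "{z} \<in> lcarrier (tensor L1 L2)"
  unfolding tensor_carrier_iff
proof (intro conjI ballI)
  show "{z} \<subseteq> atoms L1 \<times> atoms L2"
    using z by simp
  fix w assume w: "w \<in> atoms L1 \<times> atoms L2 - {z}"
  obtain p q p' q' where pq: "w = (p, q)" "p \<in> atoms L1" "q \<in> atoms L2"
    and pq': "z = (p', q')" "p' \<in> atoms L1" "q' \<in> atoms L2"
    using w z by auto
  obtain c d where "c \<in> coatoms L1" "\<not> lle L1 p c" "d \<in> coatoms L2" "\<not> lle L2 q d"
    "lle L1 p' c \<or> lle L2 q' d"
  proof (cases "p = p'")
    case True
    then have "q \<noteq> q'"
      using w pq pq' by auto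
    then show thesis
      using that atoms_separated[OF L1 pq(2,2)] coatom_between_atoms[OF _ _ pq(3) pq'(3)] L2
      by auto
  next
    case False
    then show thesis
      using that atoms_separated[OF L2 pq(3,3)] coatom_between_atoms[OF _ _ pq(2) pq'(2)] L1
      by auto
  qed
  then show "\<exists>R\<in>tsr_gen L1 L2. {z} \<subseteq> R \<and> w \<notin> R"
    by (intro bexI[of _ "coatom_cross L1 L2 c d"]) (simp_all add: pq pq' coatom_cross_tsr_gen)
qed

lemma lbot_tensor [simp]: "lbot (tensor L1 L2) = {}"
  unfolding lbot_def by (rule Join_eqI) (auto simp: is_lub_def empty_in_tensor_carrier)

lemma atoms_tensor: "atoms (tensor L1 L2) = (\<lambda>z. {z}) ` (atoms L1 \<times> atoms L2)"
proof
  show "(\<lambda>z. {z}) ` (atoms L1 \<times> atoms L2) \<subseteq> atoms (tensor L1 L2)"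
    using singleton_in_tensor_carrier unfolding atoms_def by auto
  show "atoms (tensor L1 L2) \<subseteq> (\<lambda>z. {z}) ` (atoms L1 \<times> atoms L2)"
  proof
    fix X assume "X \<in> atoms (tensor L1 L2)"
    then have X: "X \<in> lcarrier (tensor L1 L2)" "X \<noteq> {}"
      and minimal: "\<And>Y. Y \<in> lcarrier (tensor L1 L2) \<Longrightarrow> Y \<subseteq> X \<Longrightarrow> Y = {} \<or> Y = X"
      unfolding atoms_def by auto
    then obtain z where "z \<in> X" "z \<in> atoms L1 \<times> atoms L2"
      using tensor_carrier_subset[OF X(1)] by blast
    with minimal[OF singleton_in_tensor_carrier, of z] show "X \<in> (\<lambda>z. {z}) ` (atoms L1 \<times> atoms L2)"
      by blast
  qed
qed

lemma tensor_atomI [simp]: "p \<in> atoms L1 \<Longrightarrow> q \<in> atoms L2 \<Longrightarrow> {(p, q)} \<in> atoms (tensor L1 L2)"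
  by (simp add: atoms_tensor)

lemma tensor_atomE:
  assumes "P \<in> atoms (tensor L1 L2)"
  obtains p q where "P = {(p, q)}" "p \<in> atoms L1" "q \<in> atoms L2"
  using assms by (auto simp: atoms_tensor)

lemma atoms_below_tensor:
  "X \<in> lcarrier (tensor L1 L2) \<Longrightarrow> atoms_below (tensor L1 L2) X = (\<lambda>z. {z}) ` X"
  by (auto simp: atoms_below_def atoms_tensor dest: tensor_carrier_subset)

text \<open>
  If \<open>(s, p)\<close> lies in \<open>R'\<close> but not in \<open>R\<close> and \<open>(a, b)\<close> lies outside \<open>R'\<close>, pick an atom \<open>r\<close> outside
  both the fibre of \<open>R\<close> over \<open>p\<close> and the fibre of \<open>R'\<close> over \<open>b\<close>. The fibres of \<open>R\<close> and \<open>R'\<close> at \<open>r\<close>,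
  and then those over \<open>p\<close>, are proper and nested, hence equal.
\<close>

lemma tsr_gen_incomparable:
  assumes R: "R \<in> tsr_gen L1 L2" and R': "R' \<in> tsr_gen L1 L2" and sub: "R \<subseteq> R'"
  shows "R = R'"
proof (rule ccontr)
  assume "R \<noteq> R'"
  then obtain s p where sp: "(s, p) \<in> R'" "(s, p) \<notin> R" "s \<in> atoms L1" "p \<in> atoms L2"
    using sub tsr_gen_subset[OF R'] by auto
  obtain a b where ab: "a \<in> atoms L1" "b \<in> atoms L2" "(a, b) \<notin> R'"
    using R' by (rule tsr_gen_avoids)
  have "{q \<in> atoms L1. (q, p) \<in> R} \<noteq> atoms L1" "{q \<in> atoms L1. (q, b) \<in> R'} \<noteq> atoms L1"
    using sp ab by auto
  then obtain r where r: "r \<in> atoms L1" "(r, p) \<notin> R" "(r, b) \<notin> R'"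
    using coatomic_sets_separated[OF L1
        tsr_gen_fibres(1)[OF R sp(4)] tsr_gen_fibres(1)[OF R' ab(2)]]
    by auto
  have "{q \<in> atoms L2. (r, q) \<in> R'} \<noteq> atoms L2"
    using r ab by auto
  then have "{q \<in> atoms L2. (r, q) \<in> R} = {q \<in> atoms L2. (r, q) \<in> R'}"
    using sub by (intro coatomic_sets_incomparable[OF L2] tsr_gen_fibres(2)[OF _ r(1)] R R') auto
  then have "(r, p) \<notin> R'"
    using r sp by auto
  then have "{q \<in> atoms L1. (q, p) \<in> R'} \<noteq> atoms L1"
    using r by auto
  then have "{q \<in> atoms L1. (q, p) \<in> R} = {q \<in> atoms L1. (q, p) \<in> R'}"
    using sub by (intro coatomic_sets_incomparable[OF L1] tsr_gen_fibres(1)[OF _ sp(4)] R R') auto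
  then show False
    using sp by auto
qed

lemma tsr_gen_separated:
  assumes R: "R \<in> tsr_gen L1 L2" and R': "R' \<in> tsr_gen L1 L2"
  obtains p q where "p \<in> atoms L1" "q \<in> atoms L2" "(p, q) \<notin> R" "(p, q) \<notin> R'"
proof -
  obtain a b where ab: "a \<in> atoms L1" "b \<in> atoms L2" "(a, b) \<notin> R"
    using R by (rule tsr_gen_avoids)
  obtain a' b' where ab': "a' \<in> atoms L1" "b' \<in> atoms L2" "(a', b') \<notin> R'"
    using R' by (rule tsr_gen_avoids)
  have "{p \<in> atoms L1. (p, b) \<in> R} \<noteq> atoms L1" "{p \<in> atoms L1. (p, b') \<in> R'} \<noteq> atoms L1"
    using ab ab' by auto
  then obtain p where p: "p \<in> atoms L1" "(p, b) \<notin> R" "(p, b') \<notin> R'"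
    using coatomic_sets_separated[OF L1
        tsr_gen_fibres(1)[OF R ab(2)] tsr_gen_fibres(1)[OF R' ab'(2)]]
    by auto
  have "{q \<in> atoms L2. (p, q) \<in> R} \<noteq> atoms L2" "{q \<in> atoms L2. (p, q) \<in> R'} \<noteq> atoms L2"
    using p ab ab' by auto
  then obtain q where "q \<in> atoms L2" "(p, q) \<notin> R" "(p, q) \<notin> R'"
    using coatomic_sets_separated[OF L2
        tsr_gen_fibres(2)[OF R p(1)] tsr_gen_fibres(2)[OF R' p(1)]]
    by auto
  with p(1) show thesis by (rule that)
qed

lemma coatoms_tensor: "coatoms (tensor L1 L2) = tsr_gen L1 L2"
proof -
  let ?full = "atoms L1 \<times> atoms L2"
  have coatom_iff: "X \<in> coatoms (tensor L1 L2) \<longleftrightarrow> X \<in> lcarrier (tensor L1 L2) \<and> X \<noteq> ?full \<and>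
    (\<forall>Y\<in>lcarrier (tensor L1 L2). X \<subseteq> Y \<longrightarrow> Y = ?full \<or> Y = X)" for X
    unfolding coatoms_def atoms_def[of "dual_lat _"] by simp
  show ?thesis
  proof (intro equalityI subsetI)
    fix X assume "X \<in> coatoms (tensor L1 L2)"
    then have X: "X \<in> lcarrier (tensor L1 L2)" "X \<noteq> ?full"
      and maximal: "\<And>Y. Y \<in> lcarrier (tensor L1 L2) \<Longrightarrow> X \<subseteq> Y \<Longrightarrow> Y = ?full \<or> Y = X"
      unfolding coatom_iff by blast+
    obtain R where "R \<in> tsr_gen L1 L2" "X \<subseteq> R"
      using X by (rule tensor_carrier_le_tsr_gen)
    with maximal[OF tsr_gen_in_carrier, of R] show "X \<in> tsr_gen L1 L2"
      by (auto simp: tsr_gen_iff)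
  next
    fix R assume R: "R \<in> tsr_gen L1 L2"
    have "Y = R" if Y: "Y \<in> lcarrier (tensor L1 L2)" "R \<subseteq> Y" "Y \<noteq> ?full" for Y
    proof -
      obtain R' where "R' \<in> tsr_gen L1 L2" "Y \<subseteq> R'"
        using Y(1,3) by (rule tensor_carrier_le_tsr_gen)
      with tsr_gen_incomparable[OF R, of R'] Y(2) show ?thesis by blast
    qed
    moreover have "R \<noteq> ?full"
      using R by (auto simp: tsr_gen_iff)
    ultimately show "R \<in> coatoms (tensor L1 L2)"
      unfolding coatom_iff using tsr_gen_in_carrier[OF R] by blast
  qed
qed

lemma atomistic_tensor: "atomistic (tensor L1 L2)"
  unfolding atomistic_def
proof
  fix X assume X: "X \<in> lcarrier (tensor L1 L2)"
  have "is_lub (tensor L1 L2) (atoms_below (tensor L1 L2) X) X"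
    using X by (auto simp: is_lub_def atoms_below_tensor)
  then show "X = Join (tensor L1 L2) (atoms_below (tensor L1 L2) X)"
    by (simp add: Join_eqI atoms_below_subset_carrier)
qed

lemma coatomistic_tensor: "coatomistic (tensor L1 L2)"
  unfolding coatomistic_def
proof
  let ?T = "tensor L1 L2"
  fix X assume X: "X \<in> lcarrier ?T"
  have "Meet ?T (coatoms_above ?T X) = X"
  proof (rule Meet_eqI[OF complete_lat_tensor _ X])
    show "coatoms_above ?T X \<subseteq> lcarrier ?T"
      by (auto simp: coatoms_above_def)
    fix Y assume "Y \<in> lcarrier ?T"
    then show "lle ?T Y X \<longleftrightarrow> (\<forall>R\<in>coatoms_above ?T X. lle ?T Y R)"
      using X unfolding tensor_carrier_iff by (auto simp: coatoms_above_def coatoms_tensor) blast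
  qed
  then show "X = Meet ?T (coatoms_above ?T X)" by simp
qed

lemma cal0sym_obj_tensor [simp]: "cal0sym_obj (tensor L1 L2)"
proof -
  let ?T = "tensor L1 L2"
  have "\<exists>P\<in>atoms ?T. \<not> P \<subseteq> R \<and> \<not> P \<subseteq> R'" if "R \<in> tsr_gen L1 L2" "R' \<in> tsr_gen L1 L2" for R R'
    using tsr_gen_separated[OF that] by (metis insert_subset tensor_atomI)
  moreover have "\<exists>R\<in>tsr_gen L1 L2. \<not> P \<subseteq> R \<and> \<not> P' \<subseteq> R" if P: "P \<in> atoms ?T" "P' \<in> atoms ?T" for P P'
  proof -
    obtain p q p' q' where pq: "P = {(p, q)}" "p \<in> atoms L1" "q \<in> atoms L2"
      and pq': "P' = {(p', q')}" "p' \<in> atoms L1" "q' \<in> atoms L2"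
      using P by (metis tensor_atomE)
    obtain c where c: "c \<in> coatoms L1" "\<not> lle L1 p c" "\<not> lle L1 p' c"
      using atoms_separated[OF L1 pq(2) pq'(2)] by blast
    obtain d where d: "d \<in> coatoms L2" "\<not> lle L2 q d" "\<not> lle L2 q' d"
      using atoms_separated[OF L2 pq(3) pq'(3)] by blast
    show ?thesis
      using c d by (intro bexI[OF _ coatom_cross_tsr_gen[OF c(1) d(1)]]) (simp add: pq pq')
  qed
  ultimately show ?thesis
    unfolding cal0sym_obj_iff_separated
    by (simp add: atomistic_tensor coatomistic_tensor coatoms_tensor)
qed

lemma coatomic_sets_tensor_iff:
  "{P \<in> atoms (tensor L1 L2). Q P} \<in> coatomic_sets (tensor L1 L2) \<longleftrightarrow>
   (\<forall>p2\<in>atoms L2. {p1 \<in> atoms L1. Q {(p1, p2)}} \<in> coatomic_sets L1) \<and>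
   (\<forall>p1\<in>atoms L1. {p2 \<in> atoms L2. Q {(p1, p2)}} \<in> coatomic_sets L2)"
proof -
  let ?R = "{z \<in> atoms L1 \<times> atoms L2. Q {z}}"
  have inj: "(\<lambda>z. {z}) ` A = (\<lambda>z. {z}) ` B \<longleftrightarrow> A = B" for A B :: "('a \<times> 'b) set"
    by (rule inj_image_eq_iff) simp
  have "{P \<in> atoms (tensor L1 L2). Q P} = (\<lambda>z. {z}) ` ?R"
    by (auto simp: atoms_tensor)
  then have "{P \<in> atoms (tensor L1 L2). Q P} \<in> coatomic_sets (tensor L1 L2) \<longleftrightarrow>
      ?R = atoms L1 \<times> atoms L2 \<or> ?R \<in> tsr_gen L1 L2"
    by (simp add: coatomic_sets_iff coatoms_tensor atoms_tensor inj
        atoms_below_tensor[OF tsr_gen_in_carrier] cong: bex_cong)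
  also have "\<dots> \<longleftrightarrow> fibrewise_coatomic L1 L2 ?R"
    using L1 L2 by (intro fibrewise_coatomic_iff_tsr_gen[symmetric]) auto
  finally show ?thesis
    by (simp add: fibrewise_coatomic_def cong: conj_cong)
qed

end

section \<open>Arrows out of a tensor product\<close>

definition atom_bimap :: "'a lat \<Rightarrow> 'b lat \<Rightarrow> 'c lat \<Rightarrow> ('a \<Rightarrow> 'b \<Rightarrow> 'c) \<Rightarrow> bool" where
  "atom_bimap L1 L2 M \<phi> \<longleftrightarrow>
     (\<forall>q\<in>atoms L2. atom_map L1 M (\<lambda>p. \<phi> p q)) \<and> (\<forall>p\<in>atoms L1. atom_map L2 M (\<phi> p))"

definition bimap_extension ::
  "'a lat \<Rightarrow> 'b lat \<Rightarrow> 'c lat \<Rightarrow> ('a \<Rightarrow> 'b \<Rightarrow> 'c) \<Rightarrow> ('a \<times> 'b) set \<Rightarrow> 'c" where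
  "bimap_extension L1 L2 M \<phi> =
     restrict (\<lambda>X. Join M {\<phi> p q | p q. (p, q) \<in> X}) (lcarrier (tensor L1 L2))"

lemma atom_map_tensor_iff:
  assumes L1: "cal0sym_obj L1" and L2: "cal0sym_obj L2"
  shows "atom_map (tensor L1 L2) M \<psi> \<longleftrightarrow> atom_bimap L1 L2 M (\<lambda>p q. \<psi> {(p, q)})"
  unfolding atom_bimap_def atom_map_def coatomic_sets_tensor_iff[OF L1 L2]
  by (simp add: atoms_tensor[OF L1 L2]) blast

lemma
  assumes L1: "cal0sym_obj L1" and L2: "cal0sym_obj L2"
    and M: "complete_lat M" "coatomistic M" and \<phi>: "atom_bimap L1 L2 M \<phi>"
  shows bimap_extension_Hom: "bimap_extension L1 L2 M \<phi> \<in> Hom (tensor L1 L2) M"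
    and bimap_extension_atom:
      "p \<in> atoms L1 \<Longrightarrow> q \<in> atoms L2 \<Longrightarrow> bimap_extension L1 L2 M \<phi> {(p, q)} = \<phi> p q"
proof -
  let ?\<psi> = "\<lambda>P. case the_elem P of (p, q) \<Rightarrow> \<phi> p q"
  have extension: "bimap_extension L1 L2 M \<phi> = atom_extension (tensor L1 L2) M ?\<psi>"
    unfolding bimap_extension_def atom_extension_def
  proof (rule restrict_ext)
    fix X assume "X \<in> lcarrier (tensor L1 L2)"
    then have "?\<psi> ` atoms_below (tensor L1 L2) X = (\<lambda>(p, q). \<phi> p q) ` X"
      by (simp add: atoms_below_tensor[OF L1 L2] image_image)
    also have "\<dots> = {\<phi> p q | p q. (p, q) \<in> X}"
      by auto
    finally show "Join M {\<phi> p q | p q. (p, q) \<in> X} = Join M (?\<psi> ` atoms_below (tensor L1 L2) X)"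
      by simp
  qed
  have "atom_map (tensor L1 L2) M ?\<psi>"
    using \<phi> by (simp add: atom_map_tensor_iff[OF L1 L2])
  moreover have "complete_lat (tensor L1 L2)" "atomistic (tensor L1 L2)"
    using L1 L2 by simp_all
  ultimately show "bimap_extension L1 L2 M \<phi> \<in> Hom (tensor L1 L2) M"
    and "p \<in> atoms L1 \<Longrightarrow> q \<in> atoms L2 \<Longrightarrow> bimap_extension L1 L2 M \<phi> {(p, q)} = \<phi> p q"
    unfolding extension using M L1 L2 by (simp_all add: atom_extension_Hom atom_extension_atom)
qed

lemma tensor_Hom_eqI:
  assumes "f \<in> Hom (tensor L1 L2) M" "g \<in> Hom (tensor L1 L2) M" "cal0sym_obj L1" "cal0sym_obj L2"
    and "\<And>p q. p \<in> atoms L1 \<Longrightarrow> q \<in> atoms L2 \<Longrightarrow> f {(p, q)} = g {(p, q)}"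
  shows "f = g"
proof (rule Hom_eqI[OF _ assms(1,2)])
  fix P assume "P \<in> atoms (tensor L1 L2)"
  then show "f P = g P"
    by (rule tensor_atomE[OF assms(3,4)]) (simp add: assms(5))
qed (simp add: assms(3,4))

lemma tensor3_Hom_eqI:
  assumes "f \<in> Hom (tensor (tensor A B) C) M" "g \<in> Hom (tensor (tensor A B) C) M"
    and "cal0sym_obj A" "cal0sym_obj B" "cal0sym_obj C"
    and "\<And>a b c. a \<in> atoms A \<Longrightarrow> b \<in> atoms B \<Longrightarrow> c \<in> atoms C \<Longrightarrow> f {({(a, b)}, c)} = g {({(a, b)}, c)}"
  shows "f = g"
proof (rule tensor_Hom_eqI[OF assms(1,2) _ assms(5)])
  fix P c assume "P \<in> atoms (tensor A B)" "c \<in> atoms C"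
  then show "f {(P, c)} = g {(P, c)}"
    by (elim tensor_atomE[OF assms(3,4)]) (simp add: assms(6))
qed (simp add: assms(3,4))

lemma Hom_empty:
  "f \<in> Hom (tensor L1 L2) M \<Longrightarrow> cal0sym_obj L1 \<Longrightarrow> cal0sym_obj L2 \<Longrightarrow> f {} = lbot M"
  using Hom_lbot[of f "tensor L1 L2" M] by simp

context
  fixes L :: "'a lat" and M1 :: "'b lat" and M2 :: "'c lat"
  assumes M1: "cal0sym_obj M1" and M2: "cal0sym_obj M2"
begin

lemma atom_map_slice_left: "q \<in> atoms M2 \<Longrightarrow> atom_map M1 (tensor M1 M2) (\<lambda>p. {(p, q)})"
  and atom_map_slice_right: "p \<in> atoms M1 \<Longrightarrow> atom_map M2 (tensor M1 M2) (\<lambda>q. {(p, q)})"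
  by (simp_all add: atom_map_def M1 M2 coatoms_tensor tsr_gen_fibres)

lemma atom_map_pair_left:
  assumes "complete_lat L" "atom_map L M1 \<phi>" "\<And>p. p \<in> atoms L \<Longrightarrow> \<phi> p \<in> atoms M1" "q \<in> atoms M2"
  shows "atom_map L (tensor M1 M2) (\<lambda>p. {(\<phi> p, q)})"
  by (rule atom_map_compose[OF _ _ _ assms(2) atom_map_slice_left]) (simp_all add: assms M1)

lemma atom_map_pair_right:
  assumes "complete_lat L" "atom_map L M2 \<phi>" "\<And>q. q \<in> atoms L \<Longrightarrow> \<phi> q \<in> atoms M2" "p \<in> atoms M1"
  shows "atom_map L (tensor M1 M2) (\<lambda>q. {(p, \<phi> q)})"
  by (rule atom_map_compose[OF _ _ _ assms(2) atom_map_slice_right]) (simp_all add: assms M2)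

end

definition strict_pair :: "'a lat \<Rightarrow> 'b lat \<Rightarrow> 'a \<Rightarrow> 'b \<Rightarrow> ('a \<times> 'b) set" where
  "strict_pair M1 M2 x y = (if x = lbot M1 \<or> y = lbot M2 then {} else {(x, y)})"

context
  fixes L1 :: "'a lat" and L2 :: "'b lat" and M1 :: "'c lat" and M2 :: "'d lat" and f1 f2
  assumes L1: "cal0sym_obj L1" and L2: "cal0sym_obj L2"
    and M1: "cal0sym_obj M1" and M2: "cal0sym_obj M2"
    and f1: "f1 \<in> Hom L1 M1" and f2: "f2 \<in> Hom L2 M2"
begin

lemma atom_bimap_strict_pair:
  "atom_bimap L1 L2 (tensor M1 M2) (\<lambda>p q. strict_pair M1 M2 (f1 p) (f2 q))"
proof -
  let ?T = "tensor M1 M2"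
  have f: "atom_map L1 M1 f1" "atom_map L2 M2 f2"
    using L1 L2 M1 M2 f1 f2 by (simp_all add: Hom_atom_map)
  have "atom_map L1 ?T (\<lambda>p. strict_pair M1 M2 (f1 p) (f2 q))" if q: "q \<in> atoms L2" for q
    using f2 q
  proof (cases rule: Hom_atom_cases)
    case lbot
    then show ?thesis
      using atom_map_const_lbot[of L1 ?T] L1 M1 M2 by (simp add: strict_pair_def)
  next
    case atom
    show ?thesis
      by (rule atom_map_cong[OF atom_map_strict_compose[OF _ _ _ f(1)
              atom_map_slice_left[OF M1 M2 atom(1)]]])
        (simp_all add: L1 M1 M2 strict_pair_def atom)
  qed
  moreover have "atom_map L2 ?T (\<lambda>q. strict_pair M1 M2 (f1 p) (f2 q))" if p: "p \<in> atoms L1" for p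
    using f1 p
  proof (cases rule: Hom_atom_cases)
    case lbot
    then show ?thesis
      using atom_map_const_lbot[of L2 ?T] L2 M1 M2 by (simp add: strict_pair_def)
  next
    case atom
    show ?thesis
      by (rule atom_map_cong[OF atom_map_strict_compose[OF _ _ _ f(2)
              atom_map_slice_right[OF M1 M2 atom(1)]]])
        (simp_all add: L2 M1 M2 strict_pair_def atom)
  qed
  ultimately show ?thesis
    by (simp add: atom_bimap_def)
qed

lemma tensor_arr_eq_bimap_extension:
  "tensor_arr L1 L2 M1 M2 f1 f2
    = bimap_extension L1 L2 (tensor M1 M2) (\<lambda>p q. strict_pair M1 M2 (f1 p) (f2 q))"
  unfolding tensor_arr_def bimap_extension_def
proof (rule restrict_ext)
  let ?T = "tensor M1 M2"
  fix X assume X: "X \<in> lcarrier (tensor L1 L2)"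
  let ?A = "{{(f1 p, f2 q)} | p q. (p, q) \<in> X \<and> f1 p \<noteq> lbot M1 \<and> f2 q \<noteq> lbot M2}"
  let ?B = "{strict_pair M1 M2 (f1 p) (f2 q) | p q. (p, q) \<in> X}"
  have "strict_pair M1 M2 (f1 p) (f2 q) \<in> lcarrier ?T" if "(p, q) \<in> X" for p q
  proof -
    have "atom_map L1 ?T (\<lambda>p. strict_pair M1 M2 (f1 p) (f2 q))" "p \<in> atoms L1"
      using atom_bimap_strict_pair tensor_carrier_subset[OF X] that by (auto simp: atom_bimap_def)
    then show ?thesis
      by (intro atom_map_in_carrier[of L1 ?T]) simp_all
  qed
  then have B: "?B \<subseteq> lcarrier ?T"
    by blast
  have AB: "?A \<subseteq> ?B" "?A - {lbot ?T} = ?B - {lbot ?T}"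
    using M1 M2 by (auto simp: strict_pair_def)
  show "Join ?T ?A = Join ?T ?B"
    by (rule Join_diff_lbot_cong[OF complete_lat_tensor subset_trans[OF AB(1) B] B AB(2)])
qed

lemma tensor_arr_Hom: "tensor_arr L1 L2 M1 M2 f1 f2 \<in> Hom (tensor L1 L2) (tensor M1 M2)"
  and tensor_arr_atom: "p \<in> atoms L1 \<Longrightarrow> q \<in> atoms L2 \<Longrightarrow>
    tensor_arr L1 L2 M1 M2 f1 f2 {(p, q)}
      = (if f1 p = lbot M1 \<or> f2 q = lbot M2 then {} else {(f1 p, f2 q)})"
  unfolding tensor_arr_eq_bimap_extension using atom_bimap_strict_pair L1 L2 M1 M2
  by (simp_all add: bimap_extension_Hom bimap_extension_atom strict_pair_def)

end

section \<open>Associator, symmetry and unitors\<close>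

lemma assoc_eq_bimap_extension:
  assumes A: "cal0sym_obj A" and B: "cal0sym_obj B"
  shows "assoc A B C = bimap_extension (tensor A B) C (tensor A (tensor B C))
    (\<lambda>P c. {(fst (the_elem P), {(snd (the_elem P), c)})})"
  unfolding assoc_def bimap_extension_def
proof (intro restrict_ext arg_cong[where f = "Join _"])
  fix X assume X: "X \<in> lcarrier (tensor (tensor A B) C)"
  have "\<exists>a b. P = {(a, b)}" if "(P, c) \<in> X" for P c
  proof -
    have "P \<in> atoms (tensor A B)"
      using that tensor_carrier_subset[OF X] by blast
    then show ?thesis
      by (rule tensor_atomE[OF A B]) blast
  qed
  then show "{{(a, {(b, c)})} | a b c. ({(a, b)}, c) \<in> X} =
      {{(fst (the_elem P), {(snd (the_elem P), c)})} | P c. (P, c) \<in> X}"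
    by force
qed

definition assoc_inverse ::
  "'a lat \<Rightarrow> 'b lat \<Rightarrow> 'c lat \<Rightarrow> ('a \<times> ('b \<times> 'c) set) set \<Rightarrow> (('a \<times> 'b) set \<times> 'c) set" where
  "assoc_inverse A B C = bimap_extension A (tensor B C) (tensor (tensor A B) C)
    (\<lambda>a P. {({(a, fst (the_elem P))}, snd (the_elem P))})"

context
  fixes A :: "'a lat" and B :: "'b lat" and C :: "'c lat"
  assumes A [simp]: "cal0sym_obj A" and B [simp]: "cal0sym_obj B" and C [simp]: "cal0sym_obj C"
begin

lemma assoc_Hom: "assoc A B C \<in> Hom (tensor (tensor A B) C) (tensor A (tensor B C))"
  and assoc_atom: "a \<in> atoms A \<Longrightarrow> b \<in> atoms B \<Longrightarrow> c \<in> atoms C \<Longrightarrow>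
    assoc A B C {({(a, b)}, c)} = {(a, {(b, c)})}"
proof -
  have "atom_bimap (tensor A B) C (tensor A (tensor B C))
    (\<lambda>P c. {(fst (the_elem P), {(snd (the_elem P), c)})})"
    by (auto simp: atom_bimap_def atom_map_tensor_iff elim!: tensor_atomE[OF A B]
        intro!: atom_map_pair_left atom_map_pair_right atom_map_id)
  then show "assoc A B C \<in> Hom (tensor (tensor A B) C) (tensor A (tensor B C))"
    and "a \<in> atoms A \<Longrightarrow> b \<in> atoms B \<Longrightarrow> c \<in> atoms C \<Longrightarrow>
      assoc A B C {({(a, b)}, c)} = {(a, {(b, c)})}"
    by (simp_all add: assoc_eq_bimap_extension bimap_extension_Hom bimap_extension_atom)
qed

lemma assoc_inverse_Hom:
    "assoc_inverse A B C \<in> Hom (tensor A (tensor B C)) (tensor (tensor A B) C)"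
  and assoc_inverse_atom: "a \<in> atoms A \<Longrightarrow> b \<in> atoms B \<Longrightarrow> c \<in> atoms C \<Longrightarrow>
    assoc_inverse A B C {(a, {(b, c)})} = {({(a, b)}, c)}"
proof -
  have "atom_bimap A (tensor B C) (tensor (tensor A B) C)
    (\<lambda>a P. {({(a, fst (the_elem P))}, snd (the_elem P))})"
    by (auto simp: atom_bimap_def atom_map_tensor_iff elim!: tensor_atomE[OF B C]
        intro!: atom_map_pair_left atom_map_pair_right atom_map_id)
  then show "assoc_inverse A B C \<in> Hom (tensor A (tensor B C)) (tensor (tensor A B) C)"
    and "a \<in> atoms A \<Longrightarrow> b \<in> atoms B \<Longrightarrow> c \<in> atoms C \<Longrightarrow>
      assoc_inverse A B C {(a, {(b, c)})} = {({(a, b)}, c)}"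
    by (simp_all add: assoc_inverse_def bimap_extension_Hom bimap_extension_atom)
qed

lemma assoc_iso: "iso (tensor (tensor A B) C) (tensor A (tensor B C)) (assoc A B C)"
  by (rule iso_atomsI[OF _ _ _ _ assoc_Hom assoc_inverse_Hom])
    (auto simp: assoc_atom assoc_inverse_atom elim!: tensor_atomE[rotated 2])

end

definition symm_extension :: "'a lat \<Rightarrow> 'b lat \<Rightarrow> ('a \<times> 'b) set \<Rightarrow> ('b \<times> 'a) set" where
  "symm_extension A B = bimap_extension A B (tensor B A) (\<lambda>a b. {(b, a)})"

lemma
  assumes "cal0sym_obj A" "cal0sym_obj B"
  shows symm_extension_Hom: "symm_extension A B \<in> Hom (tensor A B) (tensor B A)"
    and symm_extension_atom: "a \<in> atoms A \<Longrightarrow> b \<in> atoms B \<Longrightarrow> symm_extension A B {(a, b)} = {(b, a)}"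
proof -
  have "atom_bimap A B (tensor B A) (\<lambda>a b. {(b, a)})"
    using assms
    by (auto simp: atom_bimap_def intro!: atom_map_pair_left atom_map_pair_right atom_map_id)
  then show "symm_extension A B \<in> Hom (tensor A B) (tensor B A)"
    and "a \<in> atoms A \<Longrightarrow> b \<in> atoms B \<Longrightarrow> symm_extension A B {(a, b)} = {(b, a)}"
    using assms by (simp_all add: symm_extension_def bimap_extension_Hom bimap_extension_atom)
qed

lemma symm_extension_involutive:
  assumes A: "cal0sym_obj A" and B: "cal0sym_obj B" and X: "X \<in> lcarrier (tensor A B)"
  shows "symm_extension B A (symm_extension A B X) = X"
proof -
  have "compose (lcarrier (tensor A B)) (symm_extension B A) (symm_extension A B)
      = idA (tensor A B)"
    by (rule tensor_Hom_eqI[OF compose_Hom[OF symm_extension_Hom symm_extension_Hom] idA_Hom])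
      (simp_all add: A B compose_def idA_def symm_extension_atom)
  from fun_cong[OF this, of X] show ?thesis
    using X by (simp add: compose_def idA_def)
qed

lemma swap_subset_symm_extension:
  assumes A: "cal0sym_obj A" and B: "cal0sym_obj B" and X: "X \<in> lcarrier (tensor A B)"
  shows "prod.swap ` X \<subseteq> symm_extension A B X"
proof -
  have "{(b, a)} \<subseteq> symm_extension A B X" if ab: "(a, b) \<in> X" for a b
  proof -
    have "a \<in> atoms A" "b \<in> atoms B"
      using ab tensor_carrier_subset[OF X] by auto
    then show ?thesis
      using Hom_mono[OF _ _ symm_extension_Hom[OF A B] _ X, of "{(a, b)}"] ab
      by (simp add: A B symm_extension_atom)
  qed
  then show ?thesis by auto
qed

lemma symm_eq_symm_extension:
  assumes A: "cal0sym_obj A" and B: "cal0sym_obj B"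
  shows "symm A B = symm_extension A B"
proof -
  have "(\<lambda>(a, b). (b, a)) ` X = symm_extension A B X" if X: "X \<in> lcarrier (tensor A B)" for X
  proof
    show "(\<lambda>(a, b). (b, a)) ` X \<subseteq> symm_extension A B X"
      using swap_subset_symm_extension[OF A B X] by auto
    have "prod.swap ` symm_extension A B X \<subseteq> X"
      using swap_subset_symm_extension[OF B A Hom_in_carrier[OF symm_extension_Hom[OF A B] X]]
      by (simp add: symm_extension_involutive[OF A B X])
    then show "symm_extension A B X \<subseteq> (\<lambda>(a, b). (b, a)) ` X"
      by force
  qed
  then have "symm A B = restrict (symm_extension A B) (lcarrier (tensor A B))"
    unfolding symm_def by (rule restrict_ext)
  also have "\<dots> = symm_extension A B"
    by (rule extensional_restrict[OF Hom_extensional[OF symm_extension_Hom[OF A B]]])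
  finally show ?thesis .
qed

lemma
  assumes "cal0sym_obj A" "cal0sym_obj B"
  shows symm_Hom: "symm A B \<in> Hom (tensor A B) (tensor B A)"
    and symm_atom: "a \<in> atoms A \<Longrightarrow> b \<in> atoms B \<Longrightarrow> symm A B {(a, b)} = {(b, a)}"
  using assms by (simp_all add: symm_eq_symm_extension symm_extension_Hom symm_extension_atom)

lemma symm_iso: "cal0sym_obj A \<Longrightarrow> cal0sym_obj B \<Longrightarrow> iso (tensor A B) (tensor B A) (symm A B)"
  by (rule iso_atomsI[OF _ _ _ _ symm_Hom symm_Hom])
    (auto simp: symm_atom elim!: tensor_atomE[rotated 2])

definition right_insertion :: "'a lat \<Rightarrow> 'b lat \<Rightarrow> 'b \<Rightarrow> 'a \<Rightarrow> ('a \<times> 'b) set" where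
  "right_insertion L U u = atom_extension L (tensor L U) (\<lambda>p. {(p, u)})"

context
  fixes L :: "'a lat" and U :: "'b lat" and u :: 'b
  assumes L [simp]: "cal0sym_obj L" and U [simp]: "cal0sym_obj U" and u: "atoms U = {u}"
begin

lemma atom_bimap_fst: "atom_bimap L U L (\<lambda>p q. p)"
  using u by (auto simp: atom_bimap_def atom_map_id intro!: atom_map_from_one_atom)

lemma right_insertion_Hom: "right_insertion L U u \<in> Hom L (tensor L U)"
  and right_insertion_atom: "p \<in> atoms L \<Longrightarrow> right_insertion L U u p = {(p, u)}"
  using atom_map_slice_left[OF L U, of u] u
  by (simp_all add: right_insertion_def atom_extension_Hom atom_extension_atom)

lemma
  shows tensor_one_atom_iso: "iso (tensor L U) L (bimap_extension L U L (\<lambda>p q. p))"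
    and right_insertion_iso: "iso L (tensor L U) (right_insertion L U u)"
proof -
  note projection =
    bimap_extension_Hom[OF L U _ _ atom_bimap_fst] bimap_extension_atom[OF L U _ _ atom_bimap_fst]
  show "iso (tensor L U) L (bimap_extension L U L (\<lambda>p q. p))"
    by (rule iso_atomsI[OF _ _ _ _ projection(1) right_insertion_Hom])
      (auto simp: projection right_insertion_atom u elim!: tensor_atomE[rotated 2])
  show "iso L (tensor L U) (right_insertion L U u)"
    by (rule iso_atomsI[OF _ _ _ _ right_insertion_Hom projection(1)])
      (auto simp: projection right_insertion_atom u elim!: tensor_atomE[rotated 2])
qed

lemma right_insertion_eq:
  assumes x: "x \<in> lcarrier L"
  shows "right_insertion L U u x = atoms_below L x \<times> {u}"
proof -
  have "(p, u) \<in> right_insertion L U u x \<longleftrightarrow> lle L p x" if "p \<in> atoms L" for p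
    using iso_le_iff[OF right_insertion_iso, of p x] that x by (simp add: right_insertion_atom)
  moreover have "right_insertion L U u x \<subseteq> atoms L \<times> {u}"
    using tensor_carrier_subset[OF Hom_in_carrier[OF right_insertion_Hom x]] u by simp
  ultimately show ?thesis
    by (auto simp: atoms_below_def)
qed

end

lemma lcarrier_two [simp]: "lcarrier two = UNIV"
  and lle_two [simp]: "lle two x y \<longleftrightarrow> (x \<longrightarrow> y)"
  by (simp_all add: two_def)

lemma is_lub_two: "is_lub two A (True \<in> A)"
  by (auto simp: is_lub_def)

lemma complete_lat_two [simp]: "complete_lat two"
  using is_lub_two by (auto simp: complete_lat_def)

lemma Join_two: "Join two A \<longleftrightarrow> True \<in> A"
  by (rule Join_eqI[OF complete_lat_two _ is_lub_two]) simp

lemma Meet_two: "Meet two A \<longleftrightarrow> False \<notin> A"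
  by (rule Meet_eqI[OF complete_lat_two]) (auto, metis (full_types))

lemma lbot_two [simp]: "lbot two = False"
  and ltop_two [simp]: "ltop two = True"
  by (simp_all add: lbot_def ltop_def Join_two Meet_two)

lemma atoms_two [simp]: "atoms two = {True}"
  unfolding atoms_def by auto

lemma coatoms_two [simp]: "coatoms two = {False}"
  unfolding coatoms_def atoms_def by auto

lemma cal0sym_obj_two [simp]: "cal0sym_obj two"
proof -
  have "atoms_below two x = (if x then {True} else {})"
    and "coatoms_above two x = (if x then {} else {False})" for x
    by (auto simp: atoms_below_def coatoms_above_def)
  then show ?thesis
    unfolding cal0sym_obj_iff_separated
    by (auto simp: atomistic_def coatomistic_def Join_two Meet_two)
qed

lemma runit_eq_bimap_extension: "runit L = bimap_extension L two L (\<lambda>p b. p)"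
  unfolding runit_def bimap_extension_def
  by (intro restrict_ext arg_cong[where f = "Join L"]) (auto dest!: tensor_carrier_subset)

lemma lunit_eq_bimap_extension: "lunit L = bimap_extension two L L (\<lambda>b p. p)"
  unfolding lunit_def bimap_extension_def
  by (intro restrict_ext arg_cong[where f = "Join L"]) (auto dest!: tensor_carrier_subset)

context
  fixes L :: "'a lat"
  assumes L [simp]: "cal0sym_obj L"
begin

lemma runit_Hom: "runit L \<in> Hom (tensor L two) L"
  and runit_atom: "p \<in> atoms L \<Longrightarrow> runit L {(p, True)} = p"
  unfolding runit_eq_bimap_extension
  using atom_bimap_fst[OF L cal0sym_obj_two atoms_two]
  by (simp_all add: bimap_extension_Hom bimap_extension_atom)

lemma runit_iso: "iso (tensor L two) L (runit L)"
  unfolding runit_eq_bimap_extension by (rule tensor_one_atom_iso) simp_all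

lemma lunit_Hom: "lunit L \<in> Hom (tensor two L) L"
  and lunit_atom: "p \<in> atoms L \<Longrightarrow> lunit L {(True, p)} = p"
proof -
  have "atom_bimap two L L (\<lambda>b p. p)"
    by (auto simp: atom_bimap_def atom_map_id intro!: atom_map_from_one_atom)
  then show "lunit L \<in> Hom (tensor two L) L" "p \<in> atoms L \<Longrightarrow> lunit L {(True, p)} = p"
    by (simp_all add: lunit_eq_bimap_extension bimap_extension_Hom bimap_extension_atom)
qed

lemma lunit_iso: "iso (tensor two L) L (lunit L)"
proof -
  have "compose (lcarrier (tensor two L)) (runit L) (symm two L) = lunit L"
    by (rule tensor_Hom_eqI[OF compose_Hom[OF symm_Hom runit_Hom] lunit_Hom])
      (simp_all add: compose_def symm_atom runit_atom lunit_atom)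
  then show ?thesis
    using iso_compose[OF symm_iso runit_iso] by simp
qed

end

section \<open>The symmetric monoidal structure\<close>

lemmas arrow_intros = compose_Hom tensor_arr_Hom idA_Hom assoc_Hom symm_Hom lunit_Hom runit_Hom

lemma compose_atom: "p \<in> atoms L \<Longrightarrow> compose (lcarrier L) g f p = g (f p)"
  by (simp add: compose_def)

lemma idA_atom: "p \<in> atoms L \<Longrightarrow> idA L p = p"
  by (simp add: idA_def)

lemmas atom_simps = compose_atom idA_atom tensor_arr_atom assoc_atom symm_atom lunit_atom runit_atom
  atom_not_lbot

lemma tensor_arr_idA:
  assumes [simp]: "cal0sym_obj L1" "cal0sym_obj L2"
  shows "tensor_arr L1 L2 L1 L2 (idA L1) (idA L2) = idA (tensor L1 L2)"
  by (rule tensor_Hom_eqI) (rule arrow_intros | simp add: idA_Hom atom_simps)+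

context
  fixes L1 :: "'a1 lat" and L2 :: "'a2 lat" and M1 :: "'b1 lat" and M2 :: "'b2 lat" and f1 f2
  assumes L [simp]: "cal0sym_obj L1" "cal0sym_obj L2"
    and M [simp]: "cal0sym_obj M1" "cal0sym_obj M2"
    and f [simp]: "f1 \<in> Hom L1 M1" "f2 \<in> Hom L2 M2"
begin

lemma tensor_arr_compose:
  assumes N [simp]: "cal0sym_obj N1" "cal0sym_obj N2"
    and g [simp]: "g1 \<in> Hom M1 N1" "g2 \<in> Hom M2 N2"
  shows "tensor_arr L1 L2 N1 N2 (compose (lcarrier L1) g1 f1) (compose (lcarrier L2) g2 f2)
    = compose (lcarrier (tensor L1 L2))
        (tensor_arr M1 M2 N1 N2 g1 g2) (tensor_arr L1 L2 M1 M2 f1 f2)"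
    (is "?F = ?G")
proof (rule tensor_Hom_eqI)
  have [simp]: "compose (lcarrier L1) g1 f1 \<in> Hom L1 N1" "compose (lcarrier L2) g2 f2 \<in> Hom L2 N2"
    by (rule arrow_intros f g | simp)+
  show "?F \<in> Hom (tensor L1 L2) (tensor N1 N2)"
    by (rule tensor_arr_Hom) simp_all
  show "?G \<in> Hom (tensor L1 L2) (tensor N1 N2)"
    by (rule arrow_intros | simp)+
  fix p q assume p: "p \<in> atoms L1" and q: "q \<in> atoms L2"
  show "?F {(p, q)} = ?G {(p, q)}"
    by (cases rule: Hom_atom_cases[OF f(1) p]; cases rule: Hom_atom_cases[OF f(2) q])
       (simp_all add: p q atom_simps Hom_lbot[OF g(1)] Hom_lbot[OF g(2)]
          Hom_empty[OF tensor_arr_Hom])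
qed simp_all

lemma symm_natural:
  "compose (lcarrier (tensor L1 L2)) (symm M1 M2) (tensor_arr L1 L2 M1 M2 f1 f2)
    = compose (lcarrier (tensor L1 L2)) (tensor_arr L2 L1 M2 M1 f2 f1) (symm L1 L2)"
    (is "?F = ?G")
proof (rule tensor_Hom_eqI)
  show "?F \<in> Hom (tensor L1 L2) (tensor M2 M1)"
    by (rule arrow_intros | simp)+
  show "?G \<in> Hom (tensor L1 L2) (tensor M2 M1)"
    by (rule arrow_intros | simp)+
  fix p q assume p: "p \<in> atoms L1" and q: "q \<in> atoms L2"
  show "?F {(p, q)} = ?G {(p, q)}"
    by (cases rule: Hom_atom_cases[OF f(1) p]; cases rule: Hom_atom_cases[OF f(2) q])
       (simp_all add: p q atom_simps Hom_empty[OF symm_Hom])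
qed simp_all

lemma assoc_natural:
  assumes [simp]: "cal0sym_obj L3" "cal0sym_obj M3" and f3 [simp]: "f3 \<in> Hom L3 M3"
  shows "compose (lcarrier (tensor (tensor L1 L2) L3))
        (tensor_arr L1 (tensor L2 L3) M1 (tensor M2 M3) f1 (tensor_arr L2 L3 M2 M3 f2 f3))
        (assoc L1 L2 L3)
    = compose (lcarrier (tensor (tensor L1 L2) L3))
        (assoc M1 M2 M3)
        (tensor_arr (tensor L1 L2) L3 (tensor M1 M2) M3 (tensor_arr L1 L2 M1 M2 f1 f2) f3)"
    (is "?F = ?G")
proof (rule tensor3_Hom_eqI)
  show "?F \<in> Hom (tensor (tensor L1 L2) L3) (tensor M1 (tensor M2 M3))"
    by (rule arrow_intros | simp)+
  show "?G \<in> Hom (tensor (tensor L1 L2) L3) (tensor M1 (tensor M2 M3))"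
    by (rule arrow_intros | simp)+
  fix a b c assume a: "a \<in> atoms L1" and b: "b \<in> atoms L2" and c: "c \<in> atoms L3"
  show "?F {({(a, b)}, c)} = ?G {({(a, b)}, c)}"
    by (cases rule: Hom_atom_cases[OF f(1) a]; cases rule: Hom_atom_cases[OF f(2) b];
        cases rule: Hom_atom_cases[OF f3 c])
       (simp_all add: a b c atom_simps tensor_arr_Hom Hom_empty[OF assoc_Hom])
qed simp_all

end

lemma
  assumes L [simp]: "cal0sym_obj L" and M [simp]: "cal0sym_obj M" and f [simp]: "f \<in> Hom L M"
  shows lunit_natural: "compose (lcarrier (tensor two L)) f (lunit L)
      = compose (lcarrier (tensor two L)) (lunit M) (tensor_arr two L two M (idA two) f)"
    and runit_natural: "compose (lcarrier (tensor L two)) f (runit L)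
      = compose (lcarrier (tensor L two)) (runit M) (tensor_arr L two M two f (idA two))"
proof -
  have lunit: "compose (lcarrier (tensor two L)) f (lunit L) {(True, p)}
      = compose (lcarrier (tensor two L)) (lunit M)
          (tensor_arr two L two M (idA two) f) {(True, p)}"
    and runit: "compose (lcarrier (tensor L two)) f (runit L) {(p, True)}
      = compose (lcarrier (tensor L two)) (runit M)
          (tensor_arr L two M two f (idA two)) {(p, True)}"
    if p: "p \<in> atoms L" for p
    by (cases rule: Hom_atom_cases[OF f p];
        simp add: p idA_Hom atom_simps Hom_empty[OF lunit_Hom] Hom_empty[OF runit_Hom])+
  show "compose (lcarrier (tensor two L)) f (lunit L)
      = compose (lcarrier (tensor two L)) (lunit M) (tensor_arr two L two M (idA two) f)"
    by (rule tensor_Hom_eqI) (rule arrow_intros f | simp add: lunit)+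
  show "compose (lcarrier (tensor L two)) f (runit L)
      = compose (lcarrier (tensor L two)) (runit M) (tensor_arr L two M two f (idA two))"
    by (rule tensor_Hom_eqI) (rule arrow_intros f | simp add: runit)+
qed

lemma symm_involutive:
  assumes [simp]: "cal0sym_obj L1" "cal0sym_obj L2"
  shows "compose (lcarrier (tensor L1 L2)) (symm L2 L1) (symm L1 L2) = idA (tensor L1 L2)"
  by (rule tensor_Hom_eqI) (rule arrow_intros | simp add: atom_simps)+

lemma triangle:
  assumes [simp]: "cal0sym_obj L1" "cal0sym_obj L2"
  shows "compose (lcarrier (tensor (tensor L1 two) L2))
      (tensor_arr L1 (tensor two L2) L1 L2 (idA L1) (lunit L2)) (assoc L1 two L2)
    = tensor_arr (tensor L1 two) L2 L1 L2 (runit L1) (idA L2)"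
  by (rule tensor3_Hom_eqI) (rule arrow_intros | simp add: atom_simps arrow_intros)+

lemma pentagon:
  assumes [simp]: "cal0sym_obj L1" "cal0sym_obj L2" "cal0sym_obj L3" "cal0sym_obj L4"
  defines "S \<equiv> lcarrier (tensor (tensor (tensor L1 L2) L3) L4)"
  shows "compose S (assoc L1 L2 (tensor L3 L4)) (assoc (tensor L1 L2) L3 L4)
    = compose S
        (tensor_arr L1 (tensor (tensor L2 L3) L4) L1 (tensor L2 (tensor L3 L4))
          (idA L1) (assoc L2 L3 L4))
        (compose S (assoc L1 (tensor L2 L3) L4)
          (tensor_arr (tensor (tensor L1 L2) L3) L4 (tensor L1 (tensor L2 L3)) L4
            (assoc L1 L2 L3) (idA L4)))"
    (is "?F = ?G")
proof (rule tensor3_Hom_eqI)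
  let ?T = "tensor (tensor (tensor L1 L2) L3) L4" and ?T' = "tensor L1 (tensor L2 (tensor L3 L4))"
  show "?F \<in> Hom ?T ?T'"
    unfolding S_def by (rule arrow_intros | simp)+
  show "?G \<in> Hom ?T ?T'"
    unfolding S_def by (rule arrow_intros | simp)+
  fix P c d assume P: "P \<in> atoms (tensor L1 L2)" and c: "c \<in> atoms L3" and d: "d \<in> atoms L4"
  obtain a b where "P = {(a, b)}" "a \<in> atoms L1" "b \<in> atoms L2"
    by (rule tensor_atomE[OF _ _ P]) simp_all
  then show "?F {({(P, c)}, d)} = ?G {({(P, c)}, d)}"
    unfolding S_def by (simp add: c d atom_simps assoc_Hom idA_Hom)
qed simp_all

lemma hexagon:
  assumes [simp]: "cal0sym_obj A" "cal0sym_obj B" "cal0sym_obj C"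
  defines "S \<equiv> lcarrier (tensor (tensor A B) C)"
  shows "compose S (assoc B C A) (compose S (symm A (tensor B C)) (assoc A B C))
    = compose S (tensor_arr B (tensor A C) B (tensor C A) (idA B) (symm A C))
        (compose S (assoc B A C) (tensor_arr (tensor A B) C (tensor B A) C (symm A B) (idA C)))"
  unfolding S_def
  by (rule tensor3_Hom_eqI) (rule arrow_intros | simp add: atom_simps symm_Hom idA_Hom)+

section \<open>The internal hom\<close>

definition coatom_graph :: "'a lat \<Rightarrow> 'b lat \<Rightarrow> ('a \<Rightarrow> 'b) \<Rightarrow> ('a \<times> 'b) set" where
  "coatom_graph L M \<phi> = {(p, c) \<in> atoms L \<times> coatoms M. lle M (\<phi> p) c}"

context
  fixes L :: "'a lat" and M :: "'b lat"
  assumes L [simp]: "cal0sym_obj L" and M [simp]: "cal0sym_obj M"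
begin

lemma cal0sym_obj_ihom [simp]: "cal0sym_obj (ihom L M)"
  by (simp add: ihom_def)

lemma lle_ihom [simp]: "lle (ihom L M) R R' \<longleftrightarrow> R' \<subseteq> R"
  by (simp add: ihom_def)

lemma atoms_ihom: "atoms (ihom L M) = tsr_gen L (dual_lat M)"
  by (simp add: ihom_def coatoms_tensor)

lemma coatoms_ihom: "coatoms (ihom L M) = (\<lambda>z. {z}) ` (atoms L \<times> coatoms M)"
  by (simp add: ihom_def atoms_tensor)

lemma lbot_ihom [simp]: "lbot (ihom L M) = atoms L \<times> coatoms M"
  by (simp add: ihom_def)

lemma atom_or_lbot_ihom_iff:
  "R \<in> atoms (ihom L M) \<union> {lbot (ihom L M)} \<longleftrightarrow>
    R \<subseteq> atoms L \<times> coatoms M \<and> fibrewise_coatomic L (dual_lat M) R"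
  using fibrewise_coatomic_iff_tsr_gen[of L "dual_lat M" R] tsr_gen_subset[of R L "dual_lat M"]
  by (auto simp: atoms_ihom)

lemma coatom_graph_ihom:
  assumes \<phi>: "atom_map L M \<phi>"
  shows "coatom_graph L M \<phi> \<in> atoms (ihom L M) \<union> {lbot (ihom L M)}"
proof -
  have "{c \<in> coatoms M. lle M (\<phi> p) c} \<in> coatomic_sets (dual_lat M)" if "p \<in> atoms L" for p
    using \<phi> that by (intro coatoms_above_atom_coatomic) (simp add: atom_map_def)
  then have "fibrewise_coatomic L (dual_lat M) (coatom_graph L M \<phi>)"
    using \<phi> by (simp add: fibrewise_coatomic_def coatom_graph_def atom_map_def cong: conj_cong)
  moreover have "coatom_graph L M \<phi> \<subseteq> atoms L \<times> coatoms M"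
    by (auto simp: coatom_graph_def)
  ultimately show ?thesis
    unfolding atom_or_lbot_ihom_iff by simp
qed

lemma
  assumes R: "R \<in> atoms (ihom L M) \<union> {lbot (ihom L M)}" and p: "p \<in> atoms L"
  shows Meet_fibre_atom: "Meet M {c. (p, c) \<in> R} \<in> atoms M \<union> {lbot M}"
    and Meet_fibre_le_iff: "c \<in> coatoms M \<Longrightarrow> lle M (Meet M {c. (p, c) \<in> R}) c \<longleftrightarrow> (p, c) \<in> R"
proof -
  have R': "R \<subseteq> atoms L \<times> coatoms M" "fibrewise_coatomic L (dual_lat M) R"
    using R unfolding atom_or_lbot_ihom_iff by auto
  have "{c \<in> coatoms M. (p, c) \<in> R} \<in> coatomic_sets (dual_lat M)"
    using R'(2) p by (simp add: fibrewise_coatomic_def)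
  then obtain a where a: "a \<in> atoms M \<union> {lbot M}" "a \<in> lcarrier M"
    "{c \<in> coatoms M. (p, c) \<in> R} = coatoms_above M a"
    by (rule coatomic_sets_dualE) simp
  moreover have "{c. (p, c) \<in> R} = {c \<in> coatoms M. (p, c) \<in> R}"
    using R'(1) by auto
  ultimately have Meet_eq: "Meet M {c. (p, c) \<in> R} = a"
    by (simp add: Meet_coatoms_above)
  show "Meet M {c. (p, c) \<in> R} \<in> atoms M \<union> {lbot M}"
    unfolding Meet_eq by (rule a(1))
  show "c \<in> coatoms M \<Longrightarrow> lle M (Meet M {c. (p, c) \<in> R}) c \<longleftrightarrow> (p, c) \<in> R"
    using a(3) unfolding Meet_eq coatoms_above_def by blast
qed

lemma ev_eq_bimap_extension:
  "ev L M = bimap_extension (ihom L M) L M (\<lambda>R p. Meet M {c. (p, c) \<in> R})"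
  by (simp add: ev_def bimap_extension_def)

lemma ev_Hom: "ev L M \<in> Hom (tensor (ihom L M) L) M"
  and ev_atom: "R \<in> atoms (ihom L M) \<Longrightarrow> p \<in> atoms L \<Longrightarrow> ev L M {(R, p)} = Meet M {c. (p, c) \<in> R}"
proof -
  have Meet_atom: "Meet M {c. (p, c) \<in> R} \<in> atoms M \<union> {lbot M}"
    if "R \<in> atoms (ihom L M)" "p \<in> atoms L" for R p
    using that by (intro Meet_fibre_atom) simp_all
  have Meet_le: "lle M (Meet M {c. (p, c) \<in> R}) c \<longleftrightarrow> (p, c) \<in> R"
    if "R \<in> atoms (ihom L M)" "p \<in> atoms L" "c \<in> coatoms M" for R p c
    using that by (intro Meet_fibre_le_iff) simp_all
  have "{R \<in> atoms (ihom L M). (p, c) \<in> R} \<in> coatomic_sets (ihom L M)"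
    if "p \<in> atoms L" "c \<in> coatoms M" for p c
    using that atoms_below_coatom_coatomic[of "{(p, c)}" "ihom L M"] by (simp add: coatoms_ihom)
  moreover have "{p \<in> atoms L. (p, c) \<in> R} \<in> coatomic_sets L"
    if "R \<in> atoms (ihom L M)" "c \<in> coatoms M" for R c
    using that tsr_gen_fibres(1)[of R L "dual_lat M" c] by (simp add: atoms_ihom)
  ultimately have "atom_bimap (ihom L M) L M (\<lambda>R p. Meet M {c. (p, c) \<in> R})"
    using Meet_atom by (simp add: atom_bimap_def atom_map_def Meet_le cong: conj_cong)
  then show "ev L M \<in> Hom (tensor (ihom L M) L) M"
    and "R \<in> atoms (ihom L M) \<Longrightarrow> p \<in> atoms L \<Longrightarrow> ev L M {(R, p)} = Meet M {c. (p, c) \<in> R}"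
    by (simp_all add: ev_eq_bimap_extension bimap_extension_Hom bimap_extension_atom)
qed

end

section \<open>Closedness\<close>

definition hom_uncurry ::
  "'a lat \<Rightarrow> 'b lat \<Rightarrow> 'c lat \<Rightarrow> ('a \<Rightarrow> ('b \<times> 'c) set) \<Rightarrow> ('a \<times> 'b) set \<Rightarrow> 'c" where
  "hom_uncurry K L M g =
     compose (lcarrier (tensor K L)) (ev L M) (tensor_arr K L (ihom L M) L g (idA L))"

definition hom_curry ::
  "'a lat \<Rightarrow> 'b lat \<Rightarrow> 'c lat \<Rightarrow> (('a \<times> 'b) set \<Rightarrow> 'c) \<Rightarrow> 'a \<Rightarrow> ('b \<times> 'c) set" where
  "hom_curry K L M f = atom_extension K (ihom L M) (\<lambda>p. coatom_graph L M (\<lambda>q. f {(p, q)}))"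

context
  fixes K :: "'a lat" and L :: "'b lat" and M :: "'c lat"
  assumes K [simp]: "cal0sym_obj K" and L [simp]: "cal0sym_obj L" and M [simp]: "cal0sym_obj M"
begin

lemma hom_uncurry_Hom:
  assumes [simp]: "g \<in> Hom K (ihom L M)"
  shows "hom_uncurry K L M g \<in> Hom (tensor K L) M"
  unfolding hom_uncurry_def by (rule arrow_intros ev_Hom | simp)+

lemma hom_uncurry_le_iff:
  assumes g [simp]: "g \<in> Hom K (ihom L M)"
    and p: "p \<in> atoms K" and q: "q \<in> atoms L" and c: "c \<in> coatoms M"
  shows "lle M (hom_uncurry K L M g {(p, q)}) c \<longleftrightarrow> (q, c) \<in> g p"
  using g p
proof (cases rule: Hom_atom_cases)
  case lbot
  then have "hom_uncurry K L M g {(p, q)} = lbot M"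
    using p q by (simp add: hom_uncurry_def atom_simps idA_Hom Hom_empty[OF ev_Hom])
  then show ?thesis
    using lbot q c by (simp add: lbot_least)
next
  case atom
  then have "hom_uncurry K L M g {(p, q)} = Meet M {c. (q, c) \<in> g p}"
    using p q by (simp add: hom_uncurry_def atom_simps idA_Hom ev_atom)
  then show ?thesis
    using Meet_fibre_le_iff[OF L M, of "g p" q c] atom q c by simp
qed

lemma hom_uncurry_eq_iff:
  assumes g: "g \<in> Hom K (ihom L M)" and f: "f \<in> Hom (tensor K L) M"
  shows "hom_uncurry K L M g = f \<longleftrightarrow> (\<forall>p\<in>atoms K. g p = coatom_graph L M (\<lambda>q. f {(p, q)}))"
proof
  assume "hom_uncurry K L M g = f"
  then have "(q, c) \<in> g p \<longleftrightarrow> lle M (f {(p, q)}) c"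
    if "p \<in> atoms K" "q \<in> atoms L" "c \<in> coatoms M" for p q c
    using hom_uncurry_le_iff[OF g that] by simp
  moreover have "g p \<subseteq> atoms L \<times> coatoms M" if "p \<in> atoms K" for p
    using Hom_atom[OF g that] unfolding atom_or_lbot_ihom_iff[OF L M] by simp
  ultimately show "\<forall>p\<in>atoms K. g p = coatom_graph L M (\<lambda>q. f {(p, q)})"
    unfolding coatom_graph_def by blast
next
  assume graph: "\<forall>p\<in>atoms K. g p = coatom_graph L M (\<lambda>q. f {(p, q)})"
  show "hom_uncurry K L M g = f"
  proof (rule tensor_Hom_eqI[OF hom_uncurry_Hom[OF g] f K L])
    fix p q assume pq: "p \<in> atoms K" "q \<in> atoms L"
    then have "{(p, q)} \<in> lcarrier (tensor K L)"
      by (simp add: singleton_in_tensor_carrier)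
    then have "hom_uncurry K L M g {(p, q)} \<in> lcarrier M" "f {(p, q)} \<in> lcarrier M"
      using Hom_in_carrier[OF hom_uncurry_Hom[OF g]] Hom_in_carrier[OF f] by blast+
    then show "hom_uncurry K L M g {(p, q)} = f {(p, q)}"
      using pq graph by (intro eq_if_same_coatoms_above[of M])
        (simp_all add: hom_uncurry_le_iff[OF g] coatom_graph_def)
  qed
qed

lemma
  assumes f: "f \<in> Hom (tensor K L) M"
  shows hom_curry_Hom: "hom_curry K L M f \<in> Hom K (ihom L M)"
    and hom_uncurry_curry: "hom_uncurry K L M (hom_curry K L M f) = f"
proof -
  have bimap: "atom_bimap K L M (\<lambda>p q. f {(p, q)})"
    using Hom_atom_map[OF _ _ f] by (simp add: atom_map_tensor_iff)
  have "coatom_graph L M (\<lambda>q. f {(p, q)}) \<in> atoms (ihom L M) \<union> {lbot (ihom L M)}"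
    if "p \<in> atoms K" for p
    using bimap that by (intro coatom_graph_ihom[OF L M]) (simp add: atom_bimap_def)
  moreover have "{p \<in> atoms K. (q, c) \<in> coatom_graph L M (\<lambda>q. f {(p, q)})} \<in> coatomic_sets K"
    if "q \<in> atoms L" "c \<in> coatoms M" for q c
    using bimap that by (simp add: atom_bimap_def atom_map_def coatom_graph_def)
  ultimately have graph: "atom_map K (ihom L M) (\<lambda>p. coatom_graph L M (\<lambda>q. f {(p, q)}))"
    unfolding atom_map_def by (auto simp: coatoms_ihom)
  then show hom_curry: "hom_curry K L M f \<in> Hom K (ihom L M)"
    by (simp add: hom_curry_def atom_extension_Hom)
  show "hom_uncurry K L M (hom_curry K L M f) = f"
    unfolding hom_uncurry_eq_iff[OF hom_curry f]
    using graph by (simp add: hom_curry_def atom_extension_atom)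
qed

lemma hom_uncurry_unique:
  assumes f: "f \<in> Hom (tensor K L) M"
  shows "\<exists>!g. g \<in> Hom K (ihom L M) \<and> hom_uncurry K L M g = f"
proof (rule ex1I)
  show "hom_curry K L M f \<in> Hom K (ihom L M) \<and> hom_uncurry K L M (hom_curry K L M f) = f"
    using hom_curry_Hom[OF f] hom_uncurry_curry[OF f] by simp
  fix g assume g: "g \<in> Hom K (ihom L M) \<and> hom_uncurry K L M g = f"
  show "g = hom_curry K L M f"
  proof (rule Hom_eqI[OF _ _ hom_curry_Hom[OF f]])
    show "g \<in> Hom K (ihom L M)"
      using g by simp
    then show "g p = hom_curry K L M f p" if "p \<in> atoms K" for p
      using g that hom_uncurry_eq_iff[OF _ f] hom_curry_Hom[OF f] hom_uncurry_curry[OF f] by metis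
  qed simp
qed

end

section \<open>The dualizing object\<close>

definition double_dual :: "'a lat \<Rightarrow> 'a \<Rightarrow> (('a \<times> bool) set \<times> bool) set" where
  "double_dual L = compose (lcarrier L)
     (right_insertion (ihom L two) (dual_lat two) False) (right_insertion L (dual_lat two) False)"

lemma right_insertion_iso_ihom_two:
  "cal0sym_obj L \<Longrightarrow> iso (dual_lat L) (ihom L two) (right_insertion L (dual_lat two) False)"
  unfolding ihom_def by (intro iso_dual right_insertion_iso) simp_all

context
  fixes L :: "'a lat"
  assumes L [simp]: "cal0sym_obj L"
begin

lemma ihom_two_iso_dual: "\<exists>h. iso (ihom L two) (dual_lat L) h"
  using right_insertion_iso_ihom_two[OF L] unfolding iso_def by blast

lemma double_dual_iso: "iso L (ihom (ihom L two) two) (double_dual L)"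
proof -
  have "iso L (dual_lat (ihom L two)) (right_insertion L (dual_lat two) False)"
    using iso_dual[OF right_insertion_iso_ihom_two[OF L]] by simp
  moreover have "iso (dual_lat (ihom L two)) (ihom (ihom L two) two)
      (right_insertion (ihom L two) (dual_lat two) False)"
    by (simp add: right_insertion_iso_ihom_two)
  ultimately show ?thesis
    unfolding double_dual_def by (rule iso_compose[where M = "dual_lat (ihom L two)"]) simp_all
qed

lemma double_dual_atom:
  assumes p: "p \<in> atoms L"
  shows "double_dual L p = {R \<in> atoms (ihom L two). (p, False) \<in> R} \<times> {False}"
proof -
  have "{(p, False)} \<in> coatoms (ihom L two)"
    using p by (simp add: coatoms_ihom)
  then show ?thesis
    using p by (simp add: double_dual_def compose_atom right_insertion_atom right_insertion_eq
        atoms_below_def cong: conj_cong)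
qed

lemma hom_uncurry_double_dual:
  "hom_uncurry L (ihom L two) two (double_dual L)
    = compose (lcarrier (tensor L (ihom L two))) (ev L two) (symm L (ihom L two))"
    (is "_ = ?ev_symm")
proof -
  have ev_symm: "?ev_symm \<in> Hom (tensor L (ihom L two)) two"
    by (rule arrow_intros ev_Hom | simp)+
  have g: "double_dual L \<in> Hom L (ihom (ihom L two) two)"
    using double_dual_iso by (simp add: iso_def)
  have "lle two (?ev_symm {(p, R)}) False \<longleftrightarrow> (p, False) \<in> R"
    if "p \<in> atoms L" "R \<in> atoms (ihom L two)" for p R
    using that Meet_fibre_le_iff[OF L cal0sym_obj_two, of R p False]
    by (simp add: atom_simps ev_atom del: lle_two)
  then have "double_dual L p = coatom_graph (ihom L two) two (\<lambda>R. ?ev_symm {(p, R)})"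
    if "p \<in> atoms L" for p
    using that by (auto simp: double_dual_atom coatom_graph_def simp del: lle_two)
  then show ?thesis
    using hom_uncurry_eq_iff[OF L _ _ g ev_symm] by simp
qed

end

section \<open>The star-autonomous structure\<close>

lemma category_laws_hold: "category_laws L M N f g"
  unfolding category_laws_def by (auto intro: idA_Hom compose_Hom)

lemma tensor_bifunctor_laws_hold: "tensor_bifunctor_laws L1 L2 M1 M2 N1 N2 f1 f2 g1 g2"
  by (simp add: tensor_bifunctor_laws_def tensor_arr_Hom tensor_arr_idA tensor_arr_compose)

lemma assoc_laws_hold: "assoc_laws L1 L2 L3 M1 M2 M3 f1 f2 f3"
  by (simp add: assoc_laws_def assoc_iso assoc_natural)

lemma unit_laws_hold: "unit_laws L M f"
  by (simp add: unit_laws_def lunit_iso runit_iso lunit_natural runit_natural)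

lemma symmetry_laws_hold: "symmetry_laws L1 L2 M1 M2 f1 f2"
  by (simp add: symmetry_laws_def symm_iso symm_involutive symm_natural)

lemma pentagon_law_holds: "pentagon_law L1 L2 L3 L4"
  unfolding pentagon_law_def by (intro impI pentagon) simp_all

lemma triangle_law_holds: "triangle_law L1 L2"
  by (simp add: triangle_law_def triangle)

lemma hexagon_law_holds: "hexagon_law A B C"
  by (simp add: hexagon_law_def hexagon)

lemma closed_law_holds: "closed_law L1 L2 L3"
  by (simp add: closed_law_def ev_Hom hom_uncurry_unique[unfolded hom_uncurry_def])

lemma dualizing_law_holds: "dualizing_law L"
proof -
  have "double_dual L \<in> Hom L (ihom (ihom L two) two)" if "cal0sym_obj L"
    using double_dual_iso[OF that] by (simp add: iso_def)
  then show ?thesis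
    using ihom_two_iso_dual double_dual_iso hom_uncurry_double_dual
    unfolding dualizing_law_def hom_uncurry_def by blast
qed

theorem theorem5p5:
  shows "cal0sym_obj two \<and>
    (\<forall>L. cal0sym_obj L \<longrightarrow> cal0sym_obj (dual_lat L)) \<and>
    (\<forall>L M N f g. category_laws L M N f g) \<and>
    (\<forall>L1 L2 M1 M2 N1 N2 f1 f2 g1 g2. tensor_bifunctor_laws L1 L2 M1 M2 N1 N2 f1 f2 g1 g2) \<and>
    (\<forall>L1 L2 L3 M1 M2 M3 f1 f2 f3. assoc_laws L1 L2 L3 M1 M2 M3 f1 f2 f3) \<and>
    (\<forall>L M f. unit_laws L M f) \<and>
    (\<forall>L1 L2 M1 M2 f1 f2. symmetry_laws L1 L2 M1 M2 f1 f2) \<and>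
    (\<forall>L1 L2 L3 L4. pentagon_law L1 L2 L3 L4) \<and>
    (\<forall>L1 L2. triangle_law L1 L2) \<and>
    (\<forall>A B C. hexagon_law A B C) \<and>
    (\<forall>L1 L2 L3. closed_law L1 L2 L3) \<and>
    (\<forall>L. dualizing_law L)"
  by (simp add: category_laws_hold tensor_bifunctor_laws_hold assoc_laws_hold unit_laws_hold
      symmetry_laws_hold pentagon_law_holds triangle_law_holds hexagon_law_holds
      closed_law_holds dualizing_law_holds)

end
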